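(* Fix a threshold $\alpha$, and let $\theta_0^{\mathrm{FPR}(\alpha)}:=\Pr(R>\alpha\mid Y=0)=\mathbb E[I(R>\alpha)(1-Y)]/\mathbb E[1-Y]$. Define $$\hat\theta_n:=\frac{\sum_{i=1}^nI(R_i>\alpha)(1-Y_i)}{\sum_{i=1}^n(1-Y_i)},\quad \hat\theta^f_n:=\frac{\sum_{i=1}^nI(R_i>\alpha)(1-f(X_i))}{\sum_{i=1}^n(1-f(X_i))},\quad \hat\theta^f_{n+N}:=\frac{\sum_{i=1}^{n+N}I(R_i>\alpha)(1-f(X_i))}{\sum_{i=1}^{n+N}(1-f(X_i))}.$$ Then $\hat\theta_n$ and $\hat\theta_n^f$ are asymptotically linear with influence functions (evaluated at a single observation), respectively, $$\phi^{\mathrm{FPR}(\alpha)}(R_i,Y_i)=\frac{I(R_i>\alpha)(1-Y_i)}{\mathbb E[1-Y]}-\frac{\mathbb E[I(R>\alpha)(1-Y)]\,(1-Y_i)}{\mathbb E[1-Y]^2},$$ $$\phi^{\mathrm{FPR}(\alpha)}(R_i,f(X_i))=\frac{I(R_i>\alpha)(1-f(X_i))}{\mathbb E[1-f(X)]}-\frac{\mathbb E[I(R>\alpha)(1-f(X))]\,(1-f(X_i))}{\mathbb E[1-f(X)]^2}.$$ Furthermore, let $\hat\theta^{\mathrm{PP}}:=\hat\theta_n+\hat\omega(\hat\theta^f_{n+N}-\hat\theta^f_n)$, and suppose that $n/N\to\lambda$ and $$\hat\omega\xrightarrow{p}\frac{\mathbb E[\phi^{\mathrm{FPR}(\alpha)}(R,Y)\,\phi^{\mathrm{FPR}(\alpha)}(R,f(X))]}{\mathbb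 E[\phi^{\mathrm{FPR}(\alpha)}(R,f(X))^2]}.$$ Then $$\sqrt n\,\big(\hat\theta^{\mathrm{PP}}-\theta_0^{\mathrm{FPR}(\alpha)}\big)\xrightarrow{d}N\left(0,\ \mathbb E[\phi^{\mathrm{FPR}(\alpha)}(R,Y)^2]-\frac{\big(\mathbb E[\phi^{\mathrm{FPR}(\alpha)}(R,Y)\,\phi^{\mathrm{FPR}(\alpha)}(R,f(X))]\big)^2}{(1+\lambda)\,\mathbb E[\phi^{\mathrm{FPR}(\alpha)}(R,f(X))^2]}\right).$$
   Context: Setting: $Y\in\{0,1\}$ with $0<\Pr(Y=1)<1$; $R$ is a real-valued biomarker, which is one of the components of the covariate vector $X$; $f$ is a fixed deterministic function with $f(X)\ge0$, $\mathbb E[f(X)](1-\mathbb E[f(X)])\ne0$ and $\mathbb E[f(X)^2]<\infty$. The labeled data $(R_i,f(X_i),Y_i)_{i=1}^n$ are i.i.d. copies of $(R,f(X),Y)$; the unlabeled data $(R_i,f(X_i))_{i=n+1}^{n+N}$ are i.i.d. copies of $(R,f(X))$, independent of the labeled data. $n,N\to\infty$ with $0\le\lambda<\infty$, and $\mathbb E[\phi^{\mathrm{FPR}(\alpha)}(R,f(X))^2]>0$. An estimator $\hat\theta_n$ is asymptotically linear for $\theta$ with influence function $\phi$ if $\hat\theta_n-\theta=\frac1n\sum_{i=1}^n\phi(\text{observation } i)+o_p(n^{-1/2})$; $\hat\theta_n$ is centered at $\theta_0^{\mathrm{FPR}(\alpha)}$ and $\hat\theta^f_n$ at $\mathbb E[I(R>\alpha)(1-f(X))]/\mathbb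 E[1-f(X)]$. The expression $\phi^{\mathrm{FPR}(\alpha)}(R,f(X))$ is defined by its displayed formula (in which the expectations involve $f(X)$, not $Y$). *)

theory Defs
  imports "HOL-Probability.Probability"
begin

text \<open>
  A sample is a triangular array: \<open>Z n i \<omega>\<close> is the \<open>i\<close>-th observation (\<open>i = 1, 2, \<dots>\<close>) of the data
  set of stage \<open>n\<close>. Nothing relates different stages. A sequence of observations of which the
  first \<open>n\<close> are labeled is the case where \<open>Z n i\<close> does not depend on \<open>n\<close>; a separate stream of
  unlabeled observations, appended after position \<open>n\<close>, is another case.
\<close>

text \<open>Measurability is part of the definition, since \<open>measure\<close> is 0 on non-measurable sets.\<close>

definition conv_in_prob :: "'w measure \<Rightarrow> (nat \<Rightarrow> 'w \<Rightarrow> real) \<Rightarrow> real \<Rightarrow> bool" where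
  "conv_in_prob M Z c \<longleftrightarrow>
     (\<forall>n. Z n \<in> borel_measurable M) \<and>
     (\<forall>\<epsilon>>0. (\<lambda>n. \<P>(\<omega> in M. \<bar>Z n \<omega> - c\<bar> > \<epsilon>)) \<longlonglongrightarrow> 0)"

definition small_o_in_prob :: "'w measure \<Rightarrow> (nat \<Rightarrow> 'w \<Rightarrow> real) \<Rightarrow> (nat \<Rightarrow> real) \<Rightarrow> bool" where
  "small_o_in_prob M Z r \<longleftrightarrow> conv_in_prob M (\<lambda>n \<omega>. Z n \<omega> / r n) 0"

definition asymptotically_linear ::
  "'w measure \<Rightarrow> (nat \<Rightarrow> nat \<Rightarrow> 'w \<Rightarrow> 'z) \<Rightarrow> (nat \<Rightarrow> 'w \<Rightarrow> real) \<Rightarrow> real \<Rightarrow> ('z \<Rightarrow> real) \<Rightarrow> bool" where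
  "asymptotically_linear M Z \<theta>hat \<theta> \<phi> \<longleftrightarrow>
     small_o_in_prob M
       (\<lambda>n \<omega>. (\<theta>hat n \<omega> - \<theta>) - 1 / real n * (\<Sum>i = 1..n. \<phi> (Z n i \<omega>)))
       (\<lambda>n. real n powr (- 1 / 2))"

text \<open>\<open>indep_var\<close> of the library is restricted to two random variables with values in the same type.\<close>

definition indep_rvs ::
  "'w measure \<Rightarrow> 'a measure \<Rightarrow> ('w \<Rightarrow> 'a) \<Rightarrow> 'b measure \<Rightarrow> ('w \<Rightarrow> 'b) \<Rightarrow> bool" where
  "indep_rvs M A U B V \<longleftrightarrow> U \<in> measurable M A \<and> V \<in> measurable M B \<and>
     prob_space.indep_set M
       (sets (vimage_algebra (space M) U A)) (sets (vimage_algebra (space M) V B))"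

text \<open>The normal law with mean \<open>\<mu>\<close> and variance \<open>v\<close>, read as the point mass at \<open>\<mu>\<close> if \<open>v = 0\<close>.\<close>

definition normal_law :: "real \<Rightarrow> real \<Rightarrow> real measure" where
  "normal_law \<mu> v = (if v = 0 then return borel \<mu> else density lborel (normal_density \<mu> (sqrt v)))"

text \<open>
  In the next three definitions \<open>G\<close> is either the outcome \<open>Y\<close> or the prediction \<open>f(X)\<close>.
  \<open>R\<close> and \<open>G\<close> are population variables in the first two and families of observations in the third,
  where \<open>A\<close> is the set of indices of the observations used.
\<close>

definition fpr_param :: "'w measure \<Rightarrow> real \<Rightarrow> ('w \<Rightarrow> real) \<Rightarrow> ('w \<Rightarrow> real) \<Rightarrow> real" where
  "fpr_param M \<alpha> R G =
     (\<integral>\<omega>. indicator {\<alpha><..} (R \<omega>) * (1 - G \<omega>) \<partial>M) / (\<integral>\<omega>. 1 - G \<omega> \<partial>M)"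

definition fpr_influence ::
  "'w measure \<Rightarrow> real \<Rightarrow> ('w \<Rightarrow> real) \<Rightarrow> ('w \<Rightarrow> real) \<Rightarrow> real \<times> real \<Rightarrow> real" where
  "fpr_influence M \<alpha> R G = (\<lambda>(r, g).
     indicator {\<alpha><..} r * (1 - g) / (\<integral>\<omega>. 1 - G \<omega> \<partial>M)
     - (\<integral>\<omega>. indicator {\<alpha><..} (R \<omega>) * (1 - G \<omega>) \<partial>M) * (1 - g) / (\<integral>\<omega>. 1 - G \<omega> \<partial>M)\<^sup>2)"

definition fpr_estimator ::
  "real \<Rightarrow> nat set \<Rightarrow> (nat \<Rightarrow> 'w \<Rightarrow> real) \<Rightarrow> (nat \<Rightarrow> 'w \<Rightarrow> real) \<Rightarrow> 'w \<Rightarrow> real" where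
  "fpr_estimator \<alpha> A R G \<omega> =
     (\<Sum>i\<in>A. indicator {\<alpha><..} (R i \<omega>) * (1 - G i \<omega>)) / (\<Sum>i\<in>A. 1 - G i \<omega>)"

end

theory Submission
  imports Defs
begin

text \<open>
  Write \<open>S\<^sub>Y\<close>, \<open>S\<^sub>f\<close> for the sums of the two influence functions over the labeled observations, divided
  by \<open>sqrt n\<close>, and \<open>B\<close> for the sum of the second one over the unlabeled observations, divided by
  \<open>sqrt N\<close>. A ratio of sums differs from its linearization by the product of the averaged influence
  function with the relative error of the denominator, which is negligible by Chebyshev's inequality.
  Hence \<open>sqrt n * (\<theta>PP - \<theta>0)\<close> equals \<open>S\<^sub>Y - w p S\<^sub>f + w q B\<close> up to an error that vanishes in
  probability, where \<open>w\<close> is the limit of the weights, \<open>p = 1 / (1 + \<lambda>)\<close> is the limit of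
  \<open>N / (n + N)\<close> and \<open>q = sqrt \<lambda> / (1 + \<lambda>)\<close> that of \<open>sqrt (n N) / (n + N)\<close>. The first two terms and
  the third are independent, so the characteristic function factors, and both factors have Gaussian
  limits; \<open>p\<^sup>2 + q\<^sup>2 = p\<close> gives the variance.
\<close>

section \<open>Convergence in probability\<close>

text \<open>Two features shape the argument. Stages are unrelated, so no almost sure statement
  across stages is available: errors are controlled stage by stage through second moments, and
  \<open>l2_bounded\<close> plays the part of stochastic boundedness, being inherited by sums and by
  bounded multiples. Moreover the limit variance may be 0, for instance if \<open>F = Y\<close> and
  \<open>lam = 0\<close>, where the two influence functions agree and cancel; so the Gaussian limits
  are derived on characteristic functions in a form that admits variance 0.

  The coefficients \<open>p\<close> and \<open>q\<close> arise from
  \<open>sqrt n * ((a + b) / (n + N) - a / n)\<close>, where \<open>a\<close> and \<open>b\<close>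
  are the labeled and unlabeled sums of the second influence function: this is exactly
  \<open>q B - p S\<^sub>f\<close>, before limits are taken. With \<open>s\<close> the second moment
  of that function and \<open>C\<close> the cross moment of the two, the variance as a function of
  the weight is the labeled variance plus \<open>p (w\<^sup>2 s - 2 w C)\<close>. Since
  \<open>p\<close> factors out, \<open>C / s\<close> is the minimizer for every \<lambda>, and the
  gain is \<open>p C\<^sup>2 / s\<close>.\<close>

definition l2_bounded :: "'w measure \<Rightarrow> (nat \<Rightarrow> 'w \<Rightarrow> real) \<Rightarrow> bool" where
  "l2_bounded M Z \<longleftrightarrow>
     (\<forall>n. Z n \<in> borel_measurable M \<and> integrable M (\<lambda>\<omega>. (Z n \<omega>)\<^sup>2)) \<and>
     (\<exists>K. \<forall>n. (\<integral>\<omega>. (Z n \<omega>)\<^sup>2 \<partial>M) \<le> K)"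

lemma l2_bounded_measurable: "l2_bounded M Z \<Longrightarrow> Z n \<in> borel_measurable M"
  by (auto simp: l2_bounded_def)

lemma conv_in_prob_measurable: "conv_in_prob M Z c \<Longrightarrow> Z n \<in> borel_measurable M"
  by (auto simp: conv_in_prob_def)

lemma conv_in_prob_tendsto_0:
  "conv_in_prob M Z c \<Longrightarrow> 0 < \<epsilon> \<Longrightarrow> (\<lambda>n. \<P>(\<omega> in M. \<bar>Z n \<omega> - c\<bar> > \<epsilon>)) \<longlonglongrightarrow> 0"
  by (auto simp: conv_in_prob_def)

lemma square_add_le: "(x + y)\<^sup>2 \<le> 2 * x\<^sup>2 + 2 * y\<^sup>2" for x y :: real
  using zero_le_power2[of "x - y"] by (simp add: power2_sum power2_diff)

lemma small_o_in_prob_root_iff: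
  "small_o_in_prob M Z (\<lambda>n. real n powr (- 1 / 2)) \<longleftrightarrow> conv_in_prob M (\<lambda>n \<omega>. sqrt (real n) * Z n \<omega>) 0"
proof -
  \<comment> \<open>No case split at \<open>n = 0\<close>: there \<open>0 powr x\<close>, the
    inverse of 0 and \<open>sqrt 0\<close> are all 0, so both sides vanish.\<close>
  have "z / real n powr (- 1 / 2) = sqrt (real n) * z" for z n
  proof -
    have "real n powr (- (1 / 2)) = inverse (sqrt (real n))"
      by (simp only: powr_minus powr_half_sqrt of_nat_0_le_iff)
    then have "real n powr (- 1 / 2) = inverse (sqrt (real n))" by simp
    then show ?thesis by (simp only: divide_inverse inverse_inverse_eq mult.commute)
  qed
  then show ?thesis by (simp add: small_o_in_prob_def)
qed

context prob_space
begin

section \<open>Second moments and mean-square bounds\<close>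

lemma integrable_square_add:
  fixes X Y :: "'a \<Rightarrow> real"
  assumes [measurable]: "X \<in> borel_measurable M" "Y \<in> borel_measurable M"
    and X: "integrable M (\<lambda>\<omega>. (X \<omega>)\<^sup>2)" and Y: "integrable M (\<lambda>\<omega>. (Y \<omega>)\<^sup>2)"
  shows "integrable M (\<lambda>\<omega>. (X \<omega> + Y \<omega>)\<^sup>2)"
proof -
  have "integrable M (\<lambda>\<omega>. 2 * (X \<omega>)\<^sup>2 + 2 * (Y \<omega>)\<^sup>2)"
    using X Y by simp
  then show ?thesis
  proof (rule Bochner_Integration.integrable_bound)
    show "AE \<omega> in M. norm ((X \<omega> + Y \<omega>)\<^sup>2) \<le> norm (2 * (X \<omega>)\<^sup>2 + 2 * (Y \<omega>)\<^sup>2)"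
      using square_add_le[of "X _" "Y _"] by (intro AE_I2) simp
  qed simp
qed

text \<open>Polarization: the product is half of what remains of the square of the sum once the two
  squares are removed.\<close>

lemma integrable_mult_square:
  fixes X Y :: "'a \<Rightarrow> real"
  assumes [measurable]: "X \<in> borel_measurable M" "Y \<in> borel_measurable M"
    and X: "integrable M (\<lambda>\<omega>. (X \<omega>)\<^sup>2)" and Y: "integrable M (\<lambda>\<omega>. (Y \<omega>)\<^sup>2)"
  shows "integrable M (\<lambda>\<omega>. X \<omega> * Y \<omega>)"
proof -
  have "integrable M (\<lambda>\<omega>. ((X \<omega> + Y \<omega>)\<^sup>2 - (X \<omega>)\<^sup>2 - (Y \<omega>)\<^sup>2) / 2)"
    using integrable_square_add[OF assms] X Y by simp
  then show ?thesis by (simp add: power2_sum)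
qed

lemma l2_bounded_add:
  assumes X: "l2_bounded M X" and Y: "l2_bounded M Y"
  shows "l2_bounded M (\<lambda>n \<omega>. X n \<omega> + Y n \<omega>)"
proof -
  have [measurable]: "X n \<in> borel_measurable M" "Y n \<in> borel_measurable M" for n
    using X Y by (auto simp: l2_bounded_def)
  have i: "integrable M (\<lambda>\<omega>. (X n \<omega>)\<^sup>2)" "integrable M (\<lambda>\<omega>. (Y n \<omega>)\<^sup>2)" for n
    using X Y by (auto simp: l2_bounded_def)
  obtain K L where K: "(\<integral>\<omega>. (X n \<omega>)\<^sup>2 \<partial>M) \<le> K" and L: "(\<integral>\<omega>. (Y n \<omega>)\<^sup>2 \<partial>M) \<le> L" for n
    using X Y by (auto simp: l2_bounded_def)
  have ii: "integrable M (\<lambda>\<omega>. (X n \<omega> + Y n \<omega>)\<^sup>2)" for n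
    using integrable_square_add i by simp
  have "(\<integral>\<omega>. (X n \<omega> + Y n \<omega>)\<^sup>2 \<partial>M) \<le> (\<integral>\<omega>. 2 * (X n \<omega>)\<^sup>2 + 2 * (Y n \<omega>)\<^sup>2 \<partial>M)" for n
    using i square_add_le by (intro integral_mono ii) simp_all
  also have "(\<integral>\<omega>. 2 * (X n \<omega>)\<^sup>2 + 2 * (Y n \<omega>)\<^sup>2 \<partial>M) \<le> 2 * K + 2 * L" for n
    using K[of n] L[of n] i by simp
  finally have "(\<integral>\<omega>. (X n \<omega> + Y n \<omega>)\<^sup>2 \<partial>M) \<le> 2 * K + 2 * L" for n .
  then show ?thesis
    unfolding l2_bounded_def using ii by auto
qed

lemma l2_bounded_scale:
  fixes c :: "nat \<Rightarrow> real"
  assumes X: "l2_bounded M X" and c: "Bseq c"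
  shows "l2_bounded M (\<lambda>n \<omega>. c n * X n \<omega>)"
proof -
  have [measurable]: "X n \<in> borel_measurable M" for n
    using X by (auto simp: l2_bounded_def)
  have i: "integrable M (\<lambda>\<omega>. (X n \<omega>)\<^sup>2)" for n
    using X by (auto simp: l2_bounded_def)
  obtain K where K: "(\<integral>\<omega>. (X n \<omega>)\<^sup>2 \<partial>M) \<le> K" for n
    using X by (auto simp: l2_bounded_def)
  obtain C where C: "\<And>n. \<bar>c n\<bar> \<le> C"
    using c by (auto simp: Bseq_def)
  have "(c n)\<^sup>2 * (\<integral>\<omega>. (X n \<omega>)\<^sup>2 \<partial>M) \<le> C\<^sup>2 * K" for n
    by (intro mult_mono K) (use C[of n] in \<open>auto simp: abs_le_square_iff[symmetric]\<close>)
  then show ?thesis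
    unfolding l2_bounded_def using i by (auto simp: power_mult_distrib)
qed

section \<open>Rules for convergence in probability\<close>

lemma conv_in_probI:
  assumes "\<And>n. Z n \<in> borel_measurable M"
    and "\<And>\<epsilon>. 0 < \<epsilon> \<Longrightarrow> \<exists>g. (\<forall>\<^sub>F n in sequentially. \<P>(\<omega> in M. \<bar>Z n \<omega> - c\<bar> > \<epsilon>) \<le> g n) \<and> g \<longlonglongrightarrow> 0"
  shows "conv_in_prob M Z c"
  unfolding conv_in_prob_def
proof (intro conjI allI impI assms(1))
  fix \<epsilon> :: real assume "0 < \<epsilon>"
  from assms(2)[OF this] obtain g where g: "\<forall>\<^sub>F n in sequentially. \<P>(\<omega> in M. \<bar>Z n \<omega> - c\<bar> > \<epsilon>) \<le> g n" "g \<longlonglongrightarrow> 0"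
    by auto
  show "(\<lambda>n. \<P>(\<omega> in M. \<bar>Z n \<omega> - c\<bar> > \<epsilon>)) \<longlonglongrightarrow> 0"
    by (rule tendsto_sandwich[OF _ g(1) tendsto_const g(2)]) simp
qed

lemma prob_union_bound:
  assumes [measurable]: "Measurable.pred M P" "Measurable.pred M Q" "Measurable.pred M S"
    and "\<And>\<omega>. \<omega> \<in> space M \<Longrightarrow> S \<omega> \<Longrightarrow> P \<omega> \<or> Q \<omega>"
  shows "\<P>(\<omega> in M. S \<omega>) \<le> \<P>(\<omega> in M. P \<omega>) + \<P>(\<omega> in M. Q \<omega>)"
proof -
  have "\<P>(\<omega> in M. S \<omega>) \<le> prob ({\<omega>\<in>space M. P \<omega>} \<union> {\<omega>\<in>space M. Q \<omega>})"
    using assms(4) by (intro finite_measure_mono) auto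
  also have "\<dots> \<le> \<P>(\<omega> in M. P \<omega>) + \<P>(\<omega> in M. Q \<omega>)"
    by (intro measure_Un_le) auto
  finally show ?thesis .
qed

lemma conv_in_prob_add:
  assumes Z: "conv_in_prob M Z a" and W: "conv_in_prob M W b"
  shows "conv_in_prob M (\<lambda>n \<omega>. Z n \<omega> + W n \<omega>) (a + b)"
proof (rule conv_in_probI)
  have [measurable]: "Z n \<in> borel_measurable M" "W n \<in> borel_measurable M" for n
    using Z W by (auto simp: conv_in_prob_def)
  show "(\<lambda>\<omega>. Z n \<omega> + W n \<omega>) \<in> borel_measurable M" for n by simp
  fix \<epsilon> :: real assume e: "0 < \<epsilon>"
  let ?g = "\<lambda>n. \<P>(\<omega> in M. \<bar>Z n \<omega> - a\<bar> > \<epsilon> / 2) + \<P>(\<omega> in M. \<bar>W n \<omega> - b\<bar> > \<epsilon> / 2)"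
  have "\<P>(\<omega> in M. \<bar>Z n \<omega> + W n \<omega> - (a + b)\<bar> > \<epsilon>) \<le> ?g n" for n
  proof (rule prob_union_bound)
    fix \<omega> assume "\<bar>Z n \<omega> + W n \<omega> - (a + b)\<bar> > \<epsilon>"
    then show "\<bar>Z n \<omega> - a\<bar> > \<epsilon> / 2 \<or> \<bar>W n \<omega> - b\<bar> > \<epsilon> / 2" by linarith
  qed measurable
  moreover have "?g \<longlonglongrightarrow> 0 + 0"
    using e by (intro tendsto_add conv_in_prob_tendsto_0[OF Z] conv_in_prob_tendsto_0[OF W]) auto
  ultimately show "\<exists>g. (\<forall>\<^sub>F n in sequentially. \<P>(\<omega> in M. \<bar>Z n \<omega> + W n \<omega> - (a + b)\<bar> > \<epsilon>) \<le> g n) \<and> g \<longlonglongrightarrow> 0"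
    by (intro exI[of _ ?g]) auto
qed

lemma conv_in_prob_mult_zero:
  assumes Z: "conv_in_prob M Z 0" and W: "conv_in_prob M W 0"
  shows "conv_in_prob M (\<lambda>n \<omega>. Z n \<omega> * W n \<omega>) 0"
proof (rule conv_in_probI)
  have [measurable]: "Z n \<in> borel_measurable M" "W n \<in> borel_measurable M" for n
    using Z W by (auto simp: conv_in_prob_def)
  show "(\<lambda>\<omega>. Z n \<omega> * W n \<omega>) \<in> borel_measurable M" for n by simp
  fix \<epsilon> :: real assume e: "0 < \<epsilon>"
  \<comment> \<open>The fixed threshold 1 for \<open>W\<close> suffices: a factor of size at most 1
    cannot enlarge the other one.\<close>
  let ?g = "\<lambda>n. \<P>(\<omega> in M. \<bar>Z n \<omega> - 0\<bar> > \<epsilon>) + \<P>(\<omega> in M. \<bar>W n \<omega> - 0\<bar> > 1)"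
  have "\<P>(\<omega> in M. \<bar>Z n \<omega> * W n \<omega> - 0\<bar> > \<epsilon>) \<le> ?g n" for n
  proof (rule prob_union_bound)
    fix \<omega> assume gt: "\<bar>Z n \<omega> * W n \<omega> - 0\<bar> > \<epsilon>"
    show "\<bar>Z n \<omega> - 0\<bar> > \<epsilon> \<or> \<bar>W n \<omega> - 0\<bar> > 1"
    proof (rule ccontr)
      assume "\<not> ?thesis"
      then have "\<bar>Z n \<omega>\<bar> * \<bar>W n \<omega>\<bar> \<le> \<epsilon> * 1"
        using e by (intro mult_mono) auto
      then show False using gt by (simp add: abs_mult)
    qed
  qed measurable
  moreover have "?g \<longlonglongrightarrow> 0 + 0"
    using e by (intro tendsto_add conv_in_prob_tendsto_0[OF Z] conv_in_prob_tendsto_0[OF W]) auto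
  ultimately show "\<exists>g. (\<forall>\<^sub>F n in sequentially. \<P>(\<omega> in M. \<bar>Z n \<omega> * W n \<omega> - 0\<bar> > \<epsilon>) \<le> g n) \<and> g \<longlonglongrightarrow> 0"
    by (intro exI[of _ ?g]) auto
qed

text \<open>Chebyshev confines \<open>W n\<close> to a fixed interval with probability close to 1,
  uniformly in \<open>n\<close>; there the product is at most a constant multiple of the null
  factor.\<close>

lemma conv_in_prob_mult_l2_bounded:
  assumes Z: "conv_in_prob M Z 0" and W: "l2_bounded M W"
  shows "conv_in_prob M (\<lambda>n \<omega>. Z n \<omega> * W n \<omega>) 0"
  unfolding conv_in_prob_def
proof (intro conjI allI impI)
  have [measurable]: "Z n \<in> borel_measurable M" "W n \<in> borel_measurable M" for n
    using Z W by (auto simp: conv_in_prob_def l2_bounded_def)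
  show "(\<lambda>\<omega>. Z n \<omega> * W n \<omega>) \<in> borel_measurable M" for n by simp
  fix \<epsilon> :: real assume e: "0 < \<epsilon>"
  obtain K' where K': "\<And>n. (\<integral>\<omega>. (W n \<omega>)\<^sup>2 \<partial>M) \<le> K'"
    using W by (auto simp: l2_bounded_def)
  \<comment> \<open>Raising the bound to at least 1 makes \<open>K\<close>, and with it the radius
    \<open>B\<close> below, positive.\<close>
  define K where "K = max K' 1"
  have K: "(\<integral>\<omega>. (W n \<omega>)\<^sup>2 \<partial>M) \<le> K" and K0: "0 < K" for n
    using K'[of n] by (auto simp: K_def)
  have i: "integrable M (\<lambda>\<omega>. (W n \<omega>)\<^sup>2)" for n
    using W by (auto simp: l2_bounded_def)
  show "(\<lambda>n. \<P>(\<omega> in M. \<bar>Z n \<omega> * W n \<omega> - 0\<bar> > \<epsilon>)) \<longlonglongrightarrow> 0"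
  proof (rule order_tendstoI)
    fix \<eta> :: real assume "\<eta> < 0"
    then show "\<forall>\<^sub>F n in sequentially. \<eta> < \<P>(\<omega> in M. \<bar>Z n \<omega> * W n \<omega> - 0\<bar> > \<epsilon>)"
      by (auto intro!: always_eventually less_le_trans[of \<eta> 0])
  next
    fix \<eta> :: real assume h: "0 < \<eta>"
    \<comment> \<open>With this radius Chebyshev's bound \<open>K / B\<^sup>2\<close> is half of
      \<eta>; the other half is left for \<open>Z n\<close>.\<close>
    define B where "B = sqrt (2 * K / \<eta>)"
    have B: "0 < B" "K / B\<^sup>2 = \<eta> / 2"
      using h K0 by (auto simp: B_def)
    have 1: "\<P>(\<omega> in M. \<bar>W n \<omega>\<bar> \<ge> B) \<le> \<eta> / 2" for n
    proof -
      have "\<P>(\<omega> in M. \<bar>W n \<omega>\<bar> \<ge> B) \<le> (\<integral>\<omega>. (W n \<omega>)\<^sup>2 \<partial>M) / B\<^sup>2"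
        using second_moment_method[of "W n" B] i B by simp
      also have "\<dots> \<le> K / B\<^sup>2"
        using K by (simp add: divide_right_mono)
      finally show ?thesis using B by simp
    qed
    have 2: "\<P>(\<omega> in M. \<bar>Z n \<omega> * W n \<omega> - 0\<bar> > \<epsilon>)
        \<le> \<P>(\<omega> in M. \<bar>Z n \<omega> - 0\<bar> > \<epsilon> / B) + \<P>(\<omega> in M. \<bar>W n \<omega>\<bar> \<ge> B)" for n
    proof (rule prob_union_bound)
      fix \<omega> assume gt: "\<bar>Z n \<omega> * W n \<omega> - 0\<bar> > \<epsilon>"
      show "\<bar>Z n \<omega> - 0\<bar> > \<epsilon> / B \<or> \<bar>W n \<omega>\<bar> \<ge> B"
      proof (rule ccontr)
        assume "\<not> ?thesis"
        then have "\<bar>Z n \<omega>\<bar> * \<bar>W n \<omega>\<bar> \<le> \<epsilon> / B * B"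
          using e B(1) by (intro mult_mono) auto
        then show False using gt B(1) by (simp add: abs_mult)
      qed
    qed measurable
    have "(\<lambda>n. \<P>(\<omega> in M. \<bar>Z n \<omega> - 0\<bar> > \<epsilon> / B)) \<longlonglongrightarrow> 0"
      using e B(1) by (intro conv_in_prob_tendsto_0[OF Z]) simp
    then have "\<forall>\<^sub>F n in sequentially. \<P>(\<omega> in M. \<bar>Z n \<omega> - 0\<bar> > \<epsilon> / B) < \<eta> / 2"
      using h by (auto dest!: order_tendstoD(2)[where a = "\<eta> / 2"])
    then show "\<forall>\<^sub>F n in sequentially. \<P>(\<omega> in M. \<bar>Z n \<omega> * W n \<omega> - 0\<bar> > \<epsilon>) < \<eta>"
    proof eventually_elim
      case (elim n)
      then show ?case using 1[of n] 2[of n] by linarith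
    qed
  qed
qed

lemma conv_in_prob_const:
  assumes "c \<longlonglongrightarrow> a"
  shows "conv_in_prob M (\<lambda>n \<omega>. c n) a"
proof (rule conv_in_probI)
  fix \<epsilon> :: real assume "0 < \<epsilon>"
  then have "\<forall>\<^sub>F n in sequentially. dist (c n) a < \<epsilon>"
    using assms by (auto simp: tendsto_iff)
  then have "\<forall>\<^sub>F n in sequentially. \<P>(\<omega> in M. \<bar>c n - a\<bar> > \<epsilon>) \<le> 0"
    by eventually_elim (simp add: dist_real_def)
  then show "\<exists>g. (\<forall>\<^sub>F n in sequentially. \<P>(\<omega> in M. \<bar>c n - a\<bar> > \<epsilon>) \<le> g n) \<and> g \<longlonglongrightarrow> 0"
    by (intro exI[of _ "\<lambda>_. 0"]) simp
qed simp

lemma conv_in_prob_dominated: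
  assumes Z: "conv_in_prob M Z 0" and [measurable]: "\<And>n. W n \<in> borel_measurable M"
    and le: "\<And>n \<omega>. \<omega> \<in> space M \<Longrightarrow> \<bar>W n \<omega>\<bar> \<le> C * \<bar>Z n \<omega>\<bar>"
  shows "conv_in_prob M W 0"
proof (rule conv_in_probI)
  have [measurable]: "Z n \<in> borel_measurable M" for n
    using Z by (auto simp: conv_in_prob_def)
  fix \<epsilon> :: real assume e: "0 < \<epsilon>"
  \<comment> \<open>\<open>C\<close> is an arbitrary real; the maximum is a positive number by which
    \<epsilon> can be divided.\<close>
  define D where "D = max C 1"
  have D: "0 < D" "C \<le> D" by (auto simp: D_def)
  let ?g = "\<lambda>n. \<P>(\<omega> in M. \<bar>Z n \<omega> - 0\<bar> > \<epsilon> / D)"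
  have "\<P>(\<omega> in M. \<bar>W n \<omega> - 0\<bar> > \<epsilon>) \<le> ?g n" for n
  proof (intro finite_measure_mono subsetI CollectI)
    fix \<omega> assume w: "\<omega> \<in> {\<omega> \<in> space M. \<bar>W n \<omega> - 0\<bar> > \<epsilon>}"
    then have "\<epsilon> < C * \<bar>Z n \<omega>\<bar>" using le[of \<omega> n] by auto
    also have "\<dots> \<le> D * \<bar>Z n \<omega>\<bar>" using D by (intro mult_right_mono) auto
    finally show "\<omega> \<in> space M \<and> \<bar>Z n \<omega> - 0\<bar> > \<epsilon> / D"
      using w D by (auto simp: field_simps)
  qed measurable
  moreover have "?g \<longlonglongrightarrow> 0"
    using e D(1) by (intro conv_in_prob_tendsto_0[OF Z]) simp
  ultimately show "\<exists>g. (\<forall>\<^sub>F n in sequentially. \<P>(\<omega> in M. \<bar>W n \<omega> - 0\<bar> > \<epsilon>) \<le> g n) \<and> g \<longlonglongrightarrow> 0"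
    by (intro exI[of _ ?g]) auto
qed fact

text \<open>Serves identities that fail on an event of vanishing probability, such as those that
  divide by a random denominator.\<close>

lemma conv_in_prob_cong_prob:
  assumes Z: "conv_in_prob M Z c" and [measurable]: "\<And>n. W n \<in> borel_measurable M"
    and ne: "(\<lambda>n. \<P>(\<omega> in M. Z n \<omega> \<noteq> W n \<omega>)) \<longlonglongrightarrow> 0"
  shows "conv_in_prob M W c"
proof (rule conv_in_probI)
  have [measurable]: "Z n \<in> borel_measurable M" for n
    using Z by (auto simp: conv_in_prob_def)
  fix \<epsilon> :: real assume e: "0 < \<epsilon>"
  let ?g = "\<lambda>n. \<P>(\<omega> in M. \<bar>Z n \<omega> - c\<bar> > \<epsilon>) + \<P>(\<omega> in M. Z n \<omega> \<noteq> W n \<omega>)"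
  have "\<P>(\<omega> in M. \<bar>W n \<omega> - c\<bar> > \<epsilon>) \<le> ?g n" for n
    by (rule prob_union_bound) (measurable, auto)
  moreover have "?g \<longlonglongrightarrow> 0 + 0"
    using e by (intro tendsto_add conv_in_prob_tendsto_0[OF Z] ne)
  ultimately show "\<exists>g. (\<forall>\<^sub>F n in sequentially. \<P>(\<omega> in M. \<bar>W n \<omega> - c\<bar> > \<epsilon>) \<le> g n) \<and> g \<longlonglongrightarrow> 0"
    by (intro exI[of _ ?g]) auto
qed fact

text \<open>Serves identities that fail only at finitely many stages, such as those with an empty
  sample.\<close>

lemma conv_in_prob_cong:
  assumes Z: "conv_in_prob M Z c" and W: "\<And>n. W n \<in> borel_measurable M"
    and eq: "\<forall>\<^sub>F n in sequentially. \<forall>\<omega>\<in>space M. Z n \<omega> = W n \<omega>"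
  shows "conv_in_prob M W c"
proof (rule conv_in_prob_cong_prob[OF Z W])
  have "\<forall>\<^sub>F n in sequentially. \<P>(\<omega> in M. Z n \<omega> \<noteq> W n \<omega>) = 0"
    using eq
  proof eventually_elim
    case (elim n)
    then have "{\<omega> \<in> space M. Z n \<omega> \<noteq> W n \<omega>} = {}" by auto
    then show ?case by (simp only: measure_empty)
  qed
  then show "(\<lambda>n. \<P>(\<omega> in M. Z n \<omega> \<noteq> W n \<omega>)) \<longlonglongrightarrow> 0"
    by (rule tendsto_eventually)
qed

lemma conv_in_prob_cmult:
  assumes "conv_in_prob M Z 0"
  shows "conv_in_prob M (\<lambda>n \<omega>. c * Z n \<omega>) 0"
proof (rule conv_in_prob_dominated[OF assms, where C = "\<bar>c\<bar>"])
  show "(\<lambda>\<omega>. c * Z n \<omega>) \<in> borel_measurable M" for n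
    using conv_in_prob_measurable[OF assms] by simp
qed (simp add: abs_mult)

text \<open>Where the random denominator vanishes, division by 0 makes the quotient 0, which the conclusion tolerates.\<close>

lemma ratio_linearization:
  fixes a b :: "nat \<Rightarrow> 'i \<Rightarrow> 'a \<Rightarrow> real" and A :: "nat \<Rightarrow> 'i set"
  defines "m \<equiv> \<lambda>n. real (card (A n))"
  assumes card: "filterlim (\<lambda>n. card (A n)) at_top sequentially"
    and a: "\<And>n i. i \<in> A n \<Longrightarrow> a n i \<in> borel_measurable M"
    and b: "\<And>n i. i \<in> A n \<Longrightarrow> b n i \<in> borel_measurable M"
    and beta: "\<beta> \<noteq> 0"
    and l2_num: "l2_bounded M (\<lambda>n \<omega>. (\<Sum>i\<in>A n. (a n i \<omega> - \<theta> * b n i \<omega>) / \<beta>) / sqrt (m n))"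
    and l2_den: "l2_bounded M (\<lambda>n \<omega>. (\<Sum>i\<in>A n. b n i \<omega> - \<beta>) / sqrt (m n))"
  shows "conv_in_prob M (\<lambda>n \<omega>. sqrt (m n) *
     ((\<Sum>i\<in>A n. a n i \<omega>) / (\<Sum>i\<in>A n. b n i \<omega>) - \<theta> - 1 / m n * (\<Sum>i\<in>A n. (a n i \<omega> - \<theta> * b n i \<omega>) / \<beta>))) 0"
proof -
  note [measurable] = borel_measurable_sum[OF a] borel_measurable_sum[OF b]
  define S T where "S = (\<lambda>n \<omega>. \<Sum>i\<in>A n. a n i \<omega>)" and "T = (\<lambda>n \<omega>. \<Sum>i\<in>A n. b n i \<omega>)"
  have [measurable]: "S n \<in> borel_measurable M" "T n \<in> borel_measurable M" for n
    by (simp_all add: S_def T_def)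
  have m_top: "filterlim m at_top sequentially"
    unfolding m_def by (rule filterlim_compose[OF filterlim_real_sequentially card])
  have m_pos: "\<forall>\<^sub>F n in sequentially. 0 < m n"
    using m_top by (simp add: filterlim_at_top_dense)
  \<comment> \<open>The sign fits \<open>?U\<close> below, which is \<beta> minus the averaged
    denominator.\<close>
  have inv: "(\<lambda>n. - 1 / sqrt (m n)) \<longlonglongrightarrow> 0"
    by (intro real_tendsto_divide_at_top[OF tendsto_const] filterlim_compose[OF sqrt_at_top m_top])
  have num_eq: "(\<Sum>i\<in>A n. (a n i \<omega> - \<theta> * b n i \<omega>) / \<beta>) = (S n \<omega> - \<theta> * T n \<omega>) / \<beta>" for n \<omega>
    by (simp add: S_def T_def sum_divide_distrib[symmetric] sum_subtractf sum_distrib_left[symmetric])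
  have den_eq: "(\<Sum>i\<in>A n. b n i \<omega> - \<beta>) = T n \<omega> - m n * \<beta>" for n \<omega>
    by (simp add: T_def m_def sum_subtractf)
  let ?U = "\<lambda>n \<omega>. \<beta> - T n \<omega> / m n"
  have U: "conv_in_prob M ?U 0"
  proof (rule conv_in_prob_cong[OF conv_in_prob_mult_l2_bounded[OF conv_in_prob_const[OF inv] l2_den]])
    show "\<forall>\<^sub>F n in sequentially. \<forall>\<omega>\<in>space M.
       - 1 / sqrt (m n) * ((\<Sum>i\<in>A n. b n i \<omega> - \<beta>) / sqrt (m n)) = \<beta> - T n \<omega> / m n"
      using m_pos by eventually_elim (auto simp: den_eq field_simps)
  qed simp
  then have U': "(\<lambda>n. \<P>(\<omega> in M. \<bar>?U n \<omega> - 0\<bar> > \<epsilon>)) \<longlonglongrightarrow> 0" if "0 < \<epsilon>" for \<epsilon>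
    using that by (simp add: conv_in_prob_def)
  have V: "conv_in_prob M (\<lambda>n \<omega>. ?U n \<omega> / (T n \<omega> / m n)) 0"
  proof (rule conv_in_probI)
    fix \<epsilon> :: real assume e: "0 < \<epsilon>"
    \<comment> \<open>The first entry keeps the averaged denominator at least
      \<open>\<bar>\<beta>\<bar> / 2\<close> away from 0; given that, the second makes the quotient
      at most \<epsilon>.\<close>
    define \<delta> where "\<delta> = min (\<bar>\<beta>\<bar> / 2) (\<epsilon> * \<bar>\<beta>\<bar> / 2)"
    have d: "0 < \<delta>" using e beta by (simp add: \<delta>_def)
    have "\<P>(\<omega> in M. \<bar>?U n \<omega> / (T n \<omega> / m n) - 0\<bar> > \<epsilon>) \<le> \<P>(\<omega> in M. \<bar>?U n \<omega> - 0\<bar> > \<delta>)" for n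
    proof (intro finite_measure_mono subsetI CollectI)
      fix \<omega> assume w: "\<omega> \<in> {\<omega> \<in> space M. \<bar>?U n \<omega> / (T n \<omega> / m n) - 0\<bar> > \<epsilon>}"
      have "\<not> \<bar>?U n \<omega>\<bar> \<le> \<delta>"
      proof
        assume *: "\<bar>?U n \<omega>\<bar> \<le> \<delta>"
        then have "\<bar>\<beta>\<bar> / 2 \<le> \<bar>T n \<omega> / m n\<bar>"
          unfolding \<delta>_def by linarith
        moreover have "\<bar>?U n \<omega>\<bar> \<le> \<epsilon> * (\<bar>\<beta>\<bar> / 2)"
          using * by (simp add: \<delta>_def)
        ultimately have "\<bar>?U n \<omega>\<bar> \<le> \<epsilon> * \<bar>T n \<omega> / m n\<bar>"
          using e by (meson mult_left_mono less_imp_le order_trans)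
        moreover have "0 < \<bar>T n \<omega> / m n\<bar>"
          using \<open>\<bar>\<beta>\<bar> / 2 \<le> \<bar>T n \<omega> / m n\<bar>\<close> beta by linarith
        ultimately have "\<bar>?U n \<omega> / (T n \<omega> / m n)\<bar> \<le> \<epsilon>"
          unfolding abs_divide[of "?U n \<omega>"] by (subst pos_divide_le_eq) auto
        then show False using w by auto
      qed
      then show "\<omega> \<in> space M \<and> \<bar>?U n \<omega> - 0\<bar> > \<delta>" using w by auto
    qed measurable
    then show "\<exists>g. (\<forall>\<^sub>F n in sequentially. \<P>(\<omega> in M. \<bar>?U n \<omega> / (T n \<omega> / m n) - 0\<bar> > \<epsilon>) \<le> g n) \<and> g \<longlonglongrightarrow> 0"
      using U'[OF d] by (intro exI[of _ "\<lambda>n. \<P>(\<omega> in M. \<bar>?U n \<omega> - 0\<bar> > \<delta>)"]) auto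
  qed measurable
  \<comment> \<open>Where \<open>T n \<omega>\<close> is not 0, the remainder is exactly the
    normalized sum of the linearized terms times the relative error
    \<open>?U n \<omega> / (T n \<omega> / m n)\<close>: a mean-square bounded factor times a null
    one.\<close>
  have "conv_in_prob M (\<lambda>n \<omega>. sqrt (m n) * (S n \<omega> / T n \<omega> - \<theta> - 1 / m n * ((S n \<omega> - \<theta> * T n \<omega>) / \<beta>))) 0"
  proof (rule conv_in_prob_cong_prob[OF conv_in_prob_mult_l2_bounded[OF V l2_num]])
    let ?N = "\<lambda>n \<omega>. ?U n \<omega> / (T n \<omega> / m n) * ((\<Sum>i\<in>A n. (a n i \<omega> - \<theta> * b n i \<omega>) / \<beta>) / sqrt (m n))
      \<noteq> sqrt (m n) * (S n \<omega> / T n \<omega> - \<theta> - 1 / m n * ((S n \<omega> - \<theta> * T n \<omega>) / \<beta>))"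
    show "(\<lambda>n. \<P>(\<omega> in M. ?N n \<omega>)) \<longlonglongrightarrow> 0"
    proof (rule tendsto_sandwich[OF _ _ tendsto_const U'[of "\<bar>\<beta>\<bar> / 2"]])
      show "\<forall>\<^sub>F n in sequentially. \<P>(\<omega> in M. ?N n \<omega>) \<le> \<P>(\<omega> in M. \<bar>?U n \<omega> - 0\<bar> > \<bar>\<beta>\<bar> / 2)"
        using m_pos
      proof eventually_elim
        case (elim n)
        define s where "s = sqrt (m n)"
        have s: "0 < s" "m n = s * s" using elim by (auto simp: s_def)
        show ?case
        proof (intro finite_measure_mono subsetI CollectI)
          fix \<omega> assume w: "\<omega> \<in> {\<omega> \<in> space M. ?N n \<omega>}"
          \<comment> \<open>The identity can fail only for a zero denominator. Then
            \<open>?U n \<omega>\<close> is \<beta> itself, beyond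
            \<open>\<bar>\<beta>\<bar> / 2\<close>, and the probability of such a deviation tends to
            0.\<close>
          have "T n \<omega> = 0"
          proof (rule ccontr)
            assume "T n \<omega> \<noteq> 0"
            then have "\<not> ?N n \<omega>"
              unfolding num_eq s_def[symmetric] using s beta
              by (simp add: field_simps)
            then show False using w by auto
          qed
          then show "\<omega> \<in> space M \<and> \<bar>?U n \<omega> - 0\<bar> > \<bar>\<beta>\<bar> / 2"
            using w beta by auto
        qed measurable
      qed
    qed (use beta in simp_all)
  qed measurable
  then show ?thesis
    by (simp add: num_eq) (simp add: S_def T_def)
qed

end

section \<open>Characteristic functions and the central limit theorem for row-wise i.i.d. arrays\<close>

lemma real_distribution_normal_law:
  assumes "0 \<le> v"
  shows "real_distribution (normal_law \<mu> v)"
proof (cases "v = 0")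
  case True
  interpret prob_space "return borel \<mu>" by (rule prob_space_return) simp
  show ?thesis
    using True by (simp add: normal_law_def) (unfold_locales, auto)
next
  case False
  then have "prob_space (density lborel (normal_density \<mu> (sqrt v)))"
    using assms by (intro prob_space_normal_density) simp
  then show ?thesis
    using False by (simp add: normal_law_def real_distribution_def real_distribution_axioms_def)
qed

lemma char_normal_law_0:
  assumes "0 \<le> v"
  shows "char (normal_law 0 v) t = exp (- (v * t\<^sup>2) / 2)"
proof (cases "v = 0")
  case True
  then show ?thesis by (simp add: normal_law_def char_def integral_return)
next
  case False
  then have v: "0 < v" using assms by simp
  interpret std: real_distribution std_normal_distribution by (rule real_dist_normal_dist)
  have "distributed std_normal_distribution lborel (\<lambda>x. x) std_normal_density"
    by (auto simp: distributed_def distr_id2)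
  from std.normal_density_affine[OF this, of "sqrt v" 0]
  have "distr std_normal_distribution lborel (\<lambda>x. sqrt v * x) = normal_law 0 v"
    using v by (simp add: distributed_def normal_law_def)
  \<comment> \<open>The target of \<open>distr\<close> contributes only its space and its measurable
    sets, which \<open>lborel\<close> and \<open>borel\<close> share.\<close>
  moreover have "distr std_normal_distribution lborel (\<lambda>x. sqrt v * x) = distr std_normal_distribution borel (\<lambda>x. sqrt v * x)"
    by (rule distr_cong) simp_all
  ultimately have "char (normal_law 0 v) t = char (distr std_normal_distribution borel (\<lambda>x. sqrt v * x)) t"
    by simp
  also have "\<dots> = char std_normal_distribution (t * sqrt v)"
    unfolding char_def by (subst integral_distr) (auto simp: mult_ac)
  also have "\<dots> = exp (- (v * t\<^sup>2) / 2)"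
    using v by (simp add: char_std_normal_distribution power_mult_distrib mult.commute)
  finally show ?thesis .
qed

context prob_space
begin

section \<open>Characteristic functions of normalized sums\<close>

lemma char_scaled:
  assumes "X \<in> borel_measurable M"
  shows "char (distr M borel (\<lambda>\<omega>. c * X \<omega>)) t = char (distr M borel X) (t * c)"
proof -
  have "char (distr M borel (\<lambda>\<omega>. c * X \<omega>)) t = (CLINT \<omega>|M. iexp (t * (c * X \<omega>)))"
    unfolding char_def using assms by (intro integral_distr) auto
  moreover have "char (distr M borel X) (t * c) = (CLINT \<omega>|M. iexp (t * c * X \<omega>))"
    unfolding char_def using assms by (intro integral_distr) auto
  ultimately show ?thesis by (simp only: mult.assoc)
qed

text \<open>The \<open>m\<close>-th powers of two numbers of modulus at most 1 differ by at most
  \<open>m\<close> times the difference of the numbers. A second-order Taylor expansion whose error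
  is of smaller order than \<open>1 / m\<close> therefore allows the characteristic function to be
  replaced by \<open>?q m\<close>, whose powers tend to the exponential. Variance 0 is covered, with
  limit 1.\<close>

lemma char_power_tendsto:
  assumes W [measurable]: "W \<in> borel_measurable M"
    and W2: "integrable M (\<lambda>\<omega>. (W \<omega>)\<^sup>2)" and mean: "expectation W = 0"
  shows "(\<lambda>m. char (distr M borel W) (t / sqrt (real m)) ^ m)
    \<longlonglongrightarrow> complex_of_real (exp (- (t\<^sup>2 * expectation (\<lambda>\<omega>. (W \<omega>)\<^sup>2)) / 2))"
proof -
  define v where "v = expectation (\<lambda>\<omega>. (W \<omega>)\<^sup>2)"
  define \<mu> where "\<mu> = distr M borel W"
  interpret \<mu>: real_distribution \<mu>
    unfolding \<mu>_def by (rule real_distribution_distr) simp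
  have W1: "integrable M W"
    by (rule square_integrable_imp_integrable[OF _ W2]) simp
  have m1: "integrable \<mu> (\<lambda>x. x)" "\<mu>.expectation (\<lambda>x. x) = 0"
    and m2: "integrable \<mu> (\<lambda>x. x\<^sup>2)" "\<mu>.expectation (\<lambda>x. x\<^sup>2) = v"
    using W1 W2 mean by (simp_all add: \<mu>_def v_def integrable_distr_eq integral_distr)
  have v0: "0 \<le> v" by (simp add: v_def)
  let ?t = "\<lambda>m. t / sqrt (real m)"
  let ?I = "\<lambda>m. LINT x|\<mu>. min (6 * x\<^sup>2) (\<bar>?t m\<bar> * \<bar>x\<bar> ^ 3)"
  let ?q = "\<lambda>m. 1 + (- (t\<^sup>2 * v) / 2) / real m"
  have ev: "\<forall>\<^sub>F m in sequentially. cmod (char \<mu> (?t m) ^ m - complex_of_real (?q m ^ m)) \<le> t\<^sup>2 / 6 * ?I m"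
    \<comment> \<open>From \<open>t\<^sup>2 * v / 4\<close> on, \<open>?q m\<close> is at least -1,
      so that its modulus is at most 1, as the comparison of powers requires.\<close>
    using eventually_ge_at_top[of "nat (ceiling (t\<^sup>2 * v / 4))"] eventually_gt_at_top[of 0]
  proof eventually_elim
    case (elim m)
    have m: "t\<^sup>2 * v / 4 \<le> real m" using elim(1) by linarith
    have sq: "(?t m)\<^sup>2 = t\<^sup>2 / real m" by (simp add: power_divide)
    have "cmod (char \<mu> (?t m) - (1 - (?t m)\<^sup>2 * v / 2)) \<le> (?t m)\<^sup>2 / 6 * ?I m"
      by (rule \<mu>.char_approx3) (use m1 m2 in auto)
    then have step: "cmod (char \<mu> (?t m) - complex_of_real (?q m)) \<le> t\<^sup>2 / real m / 6 * ?I m"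
      unfolding sq by (simp add: algebra_simps)
    have "\<bar>?q m\<bar> \<le> 1"
      using m v0 elim(2) by (intro abs_leI) (auto simp: field_simps)
    then have q: "cmod (complex_of_real (?q m)) \<le> 1" by (simp only: norm_of_real)
    have "cmod (char \<mu> (?t m) ^ m - complex_of_real (?q m) ^ m)
        \<le> real m * cmod (char \<mu> (?t m) - complex_of_real (?q m))"
      by (intro norm_power_diff \<mu>.cmod_char_le_1 q)
    also have "\<dots> \<le> real m * (t\<^sup>2 / real m / 6 * ?I m)"
      using step by (intro mult_left_mono) auto
    also have "\<dots> = t\<^sup>2 / 6 * ?I m" using elim(2) by simp
    finally show ?case by simp
  qed
  have "(\<lambda>m. \<bar>?t m\<bar>) \<longlonglongrightarrow> 0"
    by (intro tendsto_rabs_zero real_tendsto_divide_at_top[OF tendsto_const]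
        filterlim_compose[OF sqrt_at_top filterlim_real_sequentially])
  then have "(\<lambda>m. min (6 * x\<^sup>2) (\<bar>?t m\<bar> * \<bar>x\<bar> ^ 3)) \<longlonglongrightarrow> min (6 * x\<^sup>2) (0 * \<bar>x\<bar> ^ 3)" for x
    by (intro tendsto_intros)
  then have pt: "(\<lambda>m. min (6 * x\<^sup>2) (\<bar>?t m\<bar> * \<bar>x\<bar> ^ 3)) \<longlonglongrightarrow> 0" for x
    by (simp add: min_absorb2)
  \<comment> \<open>The cubic term drives the integrand to 0 pointwise, while the minimum with
    \<open>6 * x\<^sup>2\<close> supplies the dominating function, so two moments are
    enough.\<close>
  have "?I \<longlonglongrightarrow> (LINT x|\<mu>. 0)"
    using pt m2(1) by (intro integral_dominated_convergence [where w = "\<lambda>x. 6 * x^2"]) auto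
  then have bound: "(\<lambda>m. t\<^sup>2 / 6 * ?I m) \<longlonglongrightarrow> 0"
    by (simp only: integral_zero tendsto_mult_right_zero)
  have "(\<lambda>m. complex_of_real (?q m ^ m)) \<longlonglongrightarrow> complex_of_real (exp (- (t\<^sup>2 * v) / 2))"
    by (rule isCont_tendsto_compose [OF _ tendsto_exp_limit_sequentially]) auto
  then show ?thesis
    unfolding v_def[symmetric] \<mu>_def[symmetric]
    by (rule Lim_transform) (rule Lim_null_comparison[OF ev bound])
qed

text \<open>Equal laws of whole observations stay equal when pushed forward along \<open>h\<close>.
  The value type is general so that pairs and triples of reals are both covered.\<close>

lemma iid_transform:
  fixes T :: "'i \<Rightarrow> 'a \<Rightarrow> 'b :: topological_space" and h :: "'b \<Rightarrow> real"
  assumes h: "h \<in> borel_measurable borel" and T0: "T0 \<in> measurable M borel"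
    and indep: "indep_vars (\<lambda>_. borel) T I"
    and copies: "\<And>i. i \<in> I \<Longrightarrow> distr M borel (T i) = distr M borel T0"
  shows "indep_vars (\<lambda>_. borel) (\<lambda>i \<omega>. h (T i \<omega>)) I"
    and "i \<in> I \<Longrightarrow> distr M borel (\<lambda>\<omega>. h (T i \<omega>)) = distr M borel (\<lambda>\<omega>. h (T0 \<omega>))"
    and "i \<in> I \<Longrightarrow> integrable M (\<lambda>\<omega>. h (T i \<omega>)) = integrable M (\<lambda>\<omega>. h (T0 \<omega>))"
    and "i \<in> I \<Longrightarrow> expectation (\<lambda>\<omega>. h (T i \<omega>)) = expectation (\<lambda>\<omega>. h (T0 \<omega>))"
    and "i \<in> I \<Longrightarrow> T i \<in> measurable M borel"
proof -
  show rv: "i \<in> I \<Longrightarrow> T i \<in> measurable M borel" for i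
    using indep by (auto simp: indep_vars_def2)
  show "indep_vars (\<lambda>_. borel) (\<lambda>i \<omega>. h (T i \<omega>)) I"
    by (rule indep_vars_compose2[OF indep]) (use h in auto)
  show "distr M borel (\<lambda>\<omega>. h (T i \<omega>)) = distr M borel (\<lambda>\<omega>. h (T0 \<omega>))" if "i \<in> I"
    using arg_cong[OF copies[OF that], of "\<lambda>D. distr D borel h"] rv[OF that] h T0
    by (simp add: distr_distr comp_def)
  show "integrable M (\<lambda>\<omega>. h (T i \<omega>)) = integrable M (\<lambda>\<omega>. h (T0 \<omega>))" if "i \<in> I"
    using integrable_distr_eq[OF rv[OF that] h] integrable_distr_eq[OF T0 h] copies[OF that] by simp
  show "expectation (\<lambda>\<omega>. h (T i \<omega>)) = expectation (\<lambda>\<omega>. h (T0 \<omega>))" if "i \<in> I"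
    using integral_distr[OF rv[OF that] h] integral_distr[OF T0 h] copies[OF that] by simp
qed

text \<open>When a summand is added, its cross term with the earlier ones factors by independence
  and vanishes because the new summand is centered.\<close>

lemma second_moment_sum:
  fixes Z :: "'i \<Rightarrow> 'a \<Rightarrow> real"
  assumes fin: "finite I" and indep: "indep_vars (\<lambda>_. borel) Z I"
    and sq: "\<And>i. i \<in> I \<Longrightarrow> integrable M (\<lambda>\<omega>. (Z i \<omega>)\<^sup>2)"
    and mean: "\<And>i. i \<in> I \<Longrightarrow> expectation (Z i) = 0"
  shows "integrable M (\<lambda>\<omega>. (\<Sum>i\<in>I. Z i \<omega>)\<^sup>2) \<and>
    expectation (\<lambda>\<omega>. (\<Sum>i\<in>I. Z i \<omega>)\<^sup>2) = (\<Sum>i\<in>I. expectation (\<lambda>\<omega>. (Z i \<omega>)\<^sup>2))"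
  using fin indep sq mean
proof (induction I rule: finite_induct)
  case (insert j J)
  have rv: "Z i \<in> borel_measurable M" if "i \<in> insert j J" for i
    using insert.prems(1) that by (auto simp: indep_vars_def2)
  have [measurable]: "Z j \<in> borel_measurable M" "(\<lambda>\<omega>. \<Sum>i\<in>J. Z i \<omega>) \<in> borel_measurable M"
    using rv by auto
  have J: "indep_vars (\<lambda>_. borel) Z J"
    by (rule indep_vars_subset[OF insert.prems(1)]) auto
  note IH = insert.IH[OF J insert.prems(2,3)]
  have iZ: "integrable M (Z j)"
    by (rule square_integrable_imp_integrable) (use insert.prems in auto)
  have iS: "integrable M (\<lambda>\<omega>. \<Sum>i\<in>J. Z i \<omega>)"
    by (rule square_integrable_imp_integrable) (use IH in auto)
  have ind: "indep_var borel (Z j) borel (\<lambda>\<omega>. \<Sum>i\<in>J. Z i \<omega>)"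
    by (rule indep_vars_sum[OF insert.hyps insert.prems(1)])
  have prod: "integrable M (\<lambda>\<omega>. Z j \<omega> * (\<Sum>i\<in>J. Z i \<omega>))"
    by (rule indep_var_integrable[OF ind iZ iS])
  have "expectation (\<lambda>\<omega>. Z j \<omega> * (\<Sum>i\<in>J. Z i \<omega>)) = expectation (Z j) * expectation (\<lambda>\<omega>. \<Sum>i\<in>J. Z i \<omega>)"
    by (rule indep_var_lebesgue_integral[OF ind iZ iS])
  then have prod0: "expectation (\<lambda>\<omega>. Z j \<omega> * (\<Sum>i\<in>J. Z i \<omega>)) = 0"
    using insert.prems(3)[of j] by simp
  have "(\<lambda>\<omega>. (\<Sum>i\<in>insert j J. Z i \<omega>)\<^sup>2)
      = (\<lambda>\<omega>. (Z j \<omega>)\<^sup>2 + (\<Sum>i\<in>J. Z i \<omega>)\<^sup>2 + 2 * (Z j \<omega> * (\<Sum>i\<in>J. Z i \<omega>)))"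
    using insert.hyps by (simp add: power2_sum mult.assoc)
  then show ?case
    using IH prod prod0 insert.prems(2) insert.hyps by simp
qed simp

text \<open>The law of an observation does not depend on the stage. So the normalized sum has the
  population second moment whenever its index set is nonempty, and its characteristic function is a
  power of one fixed function; the limit along stages is the limit for a single law composed with
  the growing sample size.\<close>

lemma iid_normalized_sum:
  fixes T :: "nat \<Rightarrow> 'i \<Rightarrow> 'a \<Rightarrow> 'b :: topological_space" and h :: "'b \<Rightarrow> real"
  assumes h: "h \<in> borel_measurable borel" and T0: "T0 \<in> measurable M borel"
    and fin: "\<And>n. finite (I n)"
    and indep: "\<And>n. indep_vars (\<lambda>_. borel) (T n) (I n)"
    and copies: "\<And>n i. i \<in> I n \<Longrightarrow> distr M borel (T n i) = distr M borel T0"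
    and sq: "integrable M (\<lambda>\<omega>. (h (T0 \<omega>))\<^sup>2)" and mean: "expectation (\<lambda>\<omega>. h (T0 \<omega>)) = 0"
  shows l2_bounded_iid_sum: "l2_bounded M (\<lambda>n \<omega>. (\<Sum>i\<in>I n. h (T n i \<omega>)) / sqrt (real (card (I n))))"
    and char_iid_sum_tendsto: "filterlim (\<lambda>n. card (I n)) at_top sequentially \<Longrightarrow>
      (\<lambda>n. char (distr M borel (\<lambda>\<omega>. (\<Sum>i\<in>I n. h (T n i \<omega>)) / sqrt (real (card (I n))))) t)
      \<longlonglongrightarrow> complex_of_real (exp (- (t\<^sup>2 * expectation (\<lambda>\<omega>. (h (T0 \<omega>))\<^sup>2)) / 2))"
proof -
  note tr = iid_transform[OF h T0 indep copies]
  have h2: "(\<lambda>x. (h x)\<^sup>2) \<in> borel_measurable borel" using h by simp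
  note tr2 = iid_transform[OF h2 T0 indep copies]
  have rv: "(\<lambda>\<omega>. \<Sum>i\<in>I n. h (T n i \<omega>)) \<in> borel_measurable M" for n
    using tr(5) by (intro borel_measurable_sum measurable_compose[OF _ h]) blast
  have *: "integrable M (\<lambda>\<omega>. (\<Sum>i\<in>I n. h (T n i \<omega>))\<^sup>2) \<and>
      expectation (\<lambda>\<omega>. (\<Sum>i\<in>I n. h (T n i \<omega>))\<^sup>2) = real (card (I n)) * expectation (\<lambda>\<omega>. (h (T0 \<omega>))\<^sup>2)" for n
  proof -
    have "(\<Sum>i\<in>I n. expectation (\<lambda>\<omega>. (h (T n i \<omega>))\<^sup>2)) = real (card (I n)) * expectation (\<lambda>\<omega>. (h (T0 \<omega>))\<^sup>2)"
      using tr2(4) by simp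
    then show ?thesis
      using second_moment_sum[OF fin tr(1)] sq mean tr2(3) tr(4) by simp
  qed
  \<comment> \<open>For an empty index set the division by \<open>sqrt 0\<close> gives 0, hence an
    inequality and not an equality.\<close>
  have "expectation (\<lambda>\<omega>. ((\<Sum>i\<in>I n. h (T n i \<omega>)) / sqrt (real (card (I n))))\<^sup>2) \<le> expectation (\<lambda>\<omega>. (h (T0 \<omega>))\<^sup>2)" for n
    using *[of n] by (cases "card (I n) = 0") (simp_all add: power_divide)
  then show "l2_bounded M (\<lambda>n \<omega>. (\<Sum>i\<in>I n. h (T n i \<omega>)) / sqrt (real (card (I n))))"
    unfolding l2_bounded_def using * rv
    by (intro conjI allI exI[of _ "expectation (\<lambda>\<omega>. (h (T0 \<omega>))\<^sup>2)"]) (auto simp: power_divide)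
  assume card: "filterlim (\<lambda>n. card (I n)) at_top sequentially"
  have "char (distr M borel (\<lambda>\<omega>. (\<Sum>i\<in>I n. h (T n i \<omega>)) / sqrt (real (card (I n))))) t
      = char (distr M borel (\<lambda>\<omega>. h (T0 \<omega>))) (t / sqrt (real (card (I n)))) ^ card (I n)" for n
  proof -
    have "char (distr M borel (\<lambda>\<omega>. (\<Sum>i\<in>I n. h (T n i \<omega>)) / sqrt (real (card (I n))))) t
      = char (distr M borel (\<lambda>\<omega>. \<Sum>i\<in>I n. h (T n i \<omega>))) (t / sqrt (real (card (I n))))"
      using char_scaled[OF rv, of "1 / sqrt (real (card (I n)))" n t]
      by (simp only: times_divide_eq_left times_divide_eq_right mult_1_left mult_1_right)
    also have "\<dots> = (\<Prod>i\<in>I n. char (distr M borel (\<lambda>\<omega>. h (T n i \<omega>))) (t / sqrt (real (card (I n)))))"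
      by (rule char_distr_sum[OF tr(1)])
    also have "\<dots> = char (distr M borel (\<lambda>\<omega>. h (T0 \<omega>))) (t / sqrt (real (card (I n)))) ^ card (I n)"
      using tr(2) by simp
    finally show ?thesis .
  qed
  then show "(\<lambda>n. char (distr M borel (\<lambda>\<omega>. (\<Sum>i\<in>I n. h (T n i \<omega>)) / sqrt (real (card (I n))))) t)
      \<longlonglongrightarrow> complex_of_real (exp (- (t\<^sup>2 * expectation (\<lambda>\<omega>. (h (T0 \<omega>))\<^sup>2)) / 2))"
    using filterlim_compose[OF char_power_tendsto[OF measurable_compose[OF T0 h] sq mean] card] by simp
qed

text \<open>The integrand \<open>iexp (t * x)\<close> is Lipschitz in \<open>x\<close> with constant
  \<open>\<bar>t\<bar>\<close>, and two of its values are never more than 2 apart. The first bound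
  serves where the variables are close, the second on the exceptional event.\<close>

lemma char_diff_le:
  assumes [measurable]: "U \<in> borel_measurable M" "V \<in> borel_measurable M" and "0 < \<epsilon>"
  shows "cmod (char (distr M borel U) t - char (distr M borel V) t)
    \<le> \<bar>t\<bar> * \<epsilon> + 2 * \<P>(\<omega> in M. \<bar>U \<omega> - V \<omega>\<bar> > \<epsilon>)"
proof -
  have int: "integrable M (\<lambda>\<omega>. iexp (t * W \<omega>))" if "W \<in> borel_measurable M" for W
    using that by (intro integrable_iexp) auto
  let ?E = "{\<omega> \<in> space M. \<bar>U \<omega> - V \<omega>\<bar> > \<epsilon>}"
  have "char (distr M borel U) t - char (distr M borel V) t = (\<integral>\<omega>. iexp (t * U \<omega>) - iexp (t * V \<omega>) \<partial>M)"
    unfolding char_def using int by (subst (1 2) integral_distr) (auto simp: Bochner_Integration.integral_diff)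
  also have "cmod \<dots> \<le> (\<integral>\<omega>. cmod (iexp (t * U \<omega>) - iexp (t * V \<omega>)) \<partial>M)"
    by (rule integral_norm_bound)
  also have "\<dots> \<le> (\<integral>\<omega>. \<bar>t\<bar> * \<epsilon> + 2 * indicator ?E \<omega> \<partial>M)"
  proof (rule integral_mono)
    show "integrable M (\<lambda>\<omega>. cmod (iexp (t * U \<omega>) - iexp (t * V \<omega>)))"
      using int by (intro integrable_norm Bochner_Integration.integrable_diff) auto
    show "integrable M (\<lambda>\<omega>. \<bar>t\<bar> * \<epsilon> + 2 * indicator ?E \<omega>)"
      by (intro Bochner_Integration.integrable_add integrable_mult_right) (auto simp: integrable_real_indicator emeasure_eq_measure)
    fix \<omega> assume w: "\<omega> \<in> space M"
    have "iexp (t * U \<omega>) - iexp (t * V \<omega>) = iexp (t * V \<omega>) * (iexp (t * (U \<omega> - V \<omega>)) - 1)"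
      by (simp add: algebra_simps exp_add[symmetric])
    then have eq: "cmod (iexp (t * U \<omega>) - iexp (t * V \<omega>)) = cmod (iexp (t * (U \<omega> - V \<omega>)) - 1)"
      by (simp add: norm_mult del: of_real_mult of_real_diff)
    show "cmod (iexp (t * U \<omega>) - iexp (t * V \<omega>)) \<le> \<bar>t\<bar> * \<epsilon> + 2 * indicator ?E \<omega>"
    proof (cases "\<bar>U \<omega> - V \<omega>\<bar> > \<epsilon>")
      case True
      have "cmod (iexp (t * (U \<omega> - V \<omega>)) - 1) \<le> 2"
        using iexp_approx2[of "t * (U \<omega> - V \<omega>)" 0] by simp
      then show ?thesis
        using True w \<open>0 < \<epsilon>\<close> unfolding eq by (simp add: add_increasing)
    next
      case False
      have "cmod (iexp (t * (U \<omega> - V \<omega>)) - 1) \<le> \<bar>t * (U \<omega> - V \<omega>)\<bar>"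
        using iexp_approx1[of "t * (U \<omega> - V \<omega>)" 0] by simp
      also have "\<dots> \<le> \<bar>t\<bar> * \<epsilon>"
        using False by (simp add: abs_mult mult_left_mono)
      finally show ?thesis using False unfolding eq by simp
    qed
  qed
  also have "\<dots> = \<bar>t\<bar> * \<epsilon> + 2 * \<P>(\<omega> in M. \<bar>U \<omega> - V \<omega>\<bar> > \<epsilon>)"
    by (subst Bochner_Integration.integral_add) (auto simp: prob_space integrable_real_indicator emeasure_eq_measure)
  finally show ?thesis .
qed

text \<open>Slutsky's lemma on the level of characteristic functions. It allows the statistic to be
  exchanged for its linear part, the only object to which independence is applied.\<close>

lemma char_tendsto_perturb:
  assumes L: "\<And>n. L n \<in> borel_measurable M" and U: "\<And>n. U n \<in> borel_measurable M"
    and diff: "conv_in_prob M (\<lambda>n \<omega>. U n \<omega> - L n \<omega>) 0"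
    and lim: "(\<lambda>n. char (distr M borel (L n)) t) \<longlonglongrightarrow> x"
  shows "(\<lambda>n. char (distr M borel (U n)) t) \<longlonglongrightarrow> x"
proof (rule Lim_transform[OF lim])
  show "(\<lambda>n. char (distr M borel (U n)) t - char (distr M borel (L n)) t) \<longlonglongrightarrow> 0"
  proof (rule tendstoI)
    fix \<eta> :: real assume h: "0 < \<eta>"
    \<comment> \<open>The summand 1 keeps the denominator positive at \<open>t = 0\<close>. The
      Lipschitz part is then at most \<open>\<eta> / 2\<close>, and twice a probability below
      \<open>\<eta> / 4\<close> supplies the rest.\<close>
    define \<epsilon> where "\<epsilon> = \<eta> / (2 * (\<bar>t\<bar> + 1))"
    have e: "0 < \<epsilon>" using h by (simp add: \<epsilon>_def add_nonneg_pos)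
    have le: "\<bar>t\<bar> * \<epsilon> \<le> \<eta> / 2"
      using h unfolding \<epsilon>_def by (simp add: field_simps)
    have "\<forall>\<^sub>F n in sequentially. \<P>(\<omega> in M. \<bar>U n \<omega> - L n \<omega> - 0\<bar> > \<epsilon>) < \<eta> / 4"
      using order_tendstoD(2)[OF conv_in_prob_tendsto_0[OF diff e], of "\<eta> / 4"] h by simp
    then show "\<forall>\<^sub>F n in sequentially.
      dist (char (distr M borel (U n)) t - char (distr M borel (L n)) t) 0 < \<eta>"
    proof eventually_elim
      case (elim n)
      then show ?case
        using char_diff_le[OF U[of n] L[of n] e, of t] le by simp
    qed
  qed
qed

text \<open>A measurable function of \<open>U\<close> generates a sigma-algebra inside that of
  \<open>U\<close>, and likewise for \<open>V\<close>. The tuples themselves may differ in type;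
  after \<open>g\<close> and \<open>h\<close> their values share one.\<close>

lemma indep_var_of_indep_rvs:
  assumes "indep_rvs M A U B V" "g \<in> measurable A N" "h \<in> measurable B N'"
  shows "indep_var N (\<lambda>\<omega>. g (U \<omega>)) N' (\<lambda>\<omega>. h (V \<omega>))"
proof -
  have rv: "U \<in> measurable M A" "V \<in> measurable M B"
    and ind: "indep_set (sets (vimage_algebra (space M) U A)) (sets (vimage_algebra (space M) V B))"
    using assms(1) by (auto simp: indep_rvs_def)
  have sub: "sigma_sets (space M) {(\<lambda>\<omega>. g (U \<omega>)) -` C \<inter> space M |C. C \<in> sets N}
      \<subseteq> sets (vimage_algebra (space M) U A)"
    if U: "U \<in> measurable M A" and g: "g \<in> measurable A N" for U :: "'a \<Rightarrow> 'x" and A g and N :: "'y measure"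
  proof -
    have "(\<lambda>\<omega>. g (U \<omega>)) \<in> measurable (vimage_algebra (space M) U A) N"
      by (rule measurable_compose[OF measurable_vimage_algebra1 g])
         (use measurable_space[OF U] in auto)
    then have "{(\<lambda>\<omega>. g (U \<omega>)) -` C \<inter> space M |C. C \<in> sets N} \<subseteq> sets (vimage_algebra (space M) U A)"
      by (auto dest: measurable_sets)
    then show ?thesis
      using sets.sigma_sets_subset[of _ "vimage_algebra (space M) U A"] by simp
  qed
  show ?thesis
    unfolding indep_var_eq
  proof (intro conjI)
    show "indep_set (sigma_sets (space M) {(\<lambda>\<omega>. g (U \<omega>)) -` C \<inter> space M |C. C \<in> sets N})
        (sigma_sets (space M) {(\<lambda>\<omega>. h (V \<omega>)) -` C \<inter> space M |C. C \<in> sets N'})"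
      using ind sub[OF rv(1) assms(2)] sub[OF rv(2) assms(3)] unfolding indep_sets2_eq
      by (meson subset_iff)
  qed (use assms rv in auto)
qed

text \<open>The pooled normalized sum combines the two normalized block sums with weights at most 1,
  so its bound follows from the block bounds. This is how the sample of all \<open>n + N n\<close>
  observations, whose independence is stated block by block, is handled.\<close>

lemma l2_bounded_union_sum:
  fixes a :: "nat \<Rightarrow> 'i \<Rightarrow> 'a \<Rightarrow> real"
  assumes fin: "\<And>n. finite (A n)" "\<And>n. finite (B n)" and disj: "\<And>n. A n \<inter> B n = {}"
    and A: "l2_bounded M (\<lambda>n \<omega>. (\<Sum>i\<in>A n. a n i \<omega>) / sqrt (real (card (A n))))"
    and B: "l2_bounded M (\<lambda>n \<omega>. (\<Sum>i\<in>B n. a n i \<omega>) / sqrt (real (card (B n))))"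
  shows "l2_bounded M (\<lambda>n \<omega>. (\<Sum>i\<in>A n \<union> B n. a n i \<omega>) / sqrt (real (card (A n \<union> B n))))"
proof -
  let ?c = "\<lambda>C n. sqrt (real (card (C n))) / sqrt (real (card (A n \<union> B n)))"
  have bounded: "Bseq (?c C)" if "\<And>n. card (C n) \<le> card (A n \<union> B n)" for C :: "nat \<Rightarrow> 'i set"
  proof (rule BseqI'[where K = 1])
    show "norm (?c C n) \<le> 1" for n
      using that[of n] by (cases "card (A n \<union> B n) = 0") (auto simp: field_simps)
  qed
  have eq: "(\<lambda>n \<omega>. (\<Sum>i\<in>A n \<union> B n. a n i \<omega>) / sqrt (real (card (A n \<union> B n)))) =
     (\<lambda>n \<omega>. ?c A n * ((\<Sum>i\<in>A n. a n i \<omega>) / sqrt (real (card (A n))))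
        + ?c B n * ((\<Sum>i\<in>B n. a n i \<omega>) / sqrt (real (card (B n)))))"
  proof (intro ext)
    fix n \<omega>
    \<comment> \<open>Right for an empty block too, whose sum is 0; finiteness ensures that
      cardinality 0 means empty.\<close>
    have s: "(\<Sum>i\<in>C n. a n i \<omega>) = sqrt (real (card (C n))) * ((\<Sum>i\<in>C n. a n i \<omega>) / sqrt (real (card (C n))))"
      if "finite (C n)" for C
      using that by (cases "card (C n) = 0") auto
    show "(\<Sum>i\<in>A n \<union> B n. a n i \<omega>) / sqrt (real (card (A n \<union> B n))) =
      ?c A n * ((\<Sum>i\<in>A n. a n i \<omega>) / sqrt (real (card (A n))))
        + ?c B n * ((\<Sum>i\<in>B n. a n i \<omega>) / sqrt (real (card (B n))))"
      using s[of A, OF fin(1)] s[of B, OF fin(2)]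
      by (simp add: sum.union_disjoint fin disj add_divide_distrib)
  qed
  show ?thesis
    unfolding eq
    by (intro l2_bounded_add l2_bounded_scale A B bounded card_mono) (auto simp: fin)
qed

text \<open>Only the limits of the weight and of the coefficients \<open>p\<close>, \<open>q\<close> matter to first order.\<close>

lemma control_variate_expansion:
  assumes D1: "conv_in_prob M D1 0" and D2: "conv_in_prob M D2 0"
    and S: "l2_bounded M S" and B: "l2_bounded M B" and T: "\<And>n. T n \<in> borel_measurable M"
    and w: "conv_in_prob M w w0" and p: "p \<longlonglongrightarrow> p0" and q: "q \<longlonglongrightarrow> q0"
  shows "conv_in_prob M (\<lambda>n \<omega>. (D1 n \<omega> + T n \<omega> + w n \<omega> * (D2 n \<omega> + (q n * B n \<omega> - p n * S n \<omega>)))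
     - ((T n \<omega> - w0 * p0 * S n \<omega>) + w0 * q0 * B n \<omega>)) 0"
proof -
  have "conv_in_prob M (\<lambda>n \<omega>. w n \<omega> + (- w0)) (w0 + (- w0))"
    by (intro conv_in_prob_add w conv_in_prob_const) simp
  then have w': "conv_in_prob M (\<lambda>n \<omega>. w n \<omega> - w0) 0" by simp
  have "(\<lambda>n. p n - p0) \<longlonglongrightarrow> p0 - p0" "(\<lambda>n. q n - q0) \<longlonglongrightarrow> q0 - q0"
    by (intro tendsto_intros p q)+
  then have p': "conv_in_prob M (\<lambda>n \<omega>. p n - p0) 0" and q': "conv_in_prob M (\<lambda>n \<omega>. q n - q0) 0"
    by (auto intro!: conv_in_prob_const)
  have pq: "Bseq q" "Bseq (\<lambda>n. - p n)"
    using p q by (auto intro!: convergent_imp_Bseq simp: Bseq_minus_iff convergent_def)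
  have Q: "l2_bounded M (\<lambda>n \<omega>. q n * B n \<omega> + (- p n) * S n \<omega>)"
    by (intro l2_bounded_add l2_bounded_scale S B pq)
  \<comment> \<open>An exact regrouping: replacing \<open>w n\<close>, \<open>p n\<close> and
    \<open>q n\<close> by their limits one at a time costs a null factor times either a mean-square
    bounded sum or another null factor.\<close>
  have "conv_in_prob M (\<lambda>n \<omega>. D1 n \<omega> + (w n \<omega> - w0) * D2 n \<omega> + w0 * D2 n \<omega>
      + (w n \<omega> - w0) * (q n * B n \<omega> + (- p n) * S n \<omega>)
      + w0 * ((q n - q0) * B n \<omega>) + (- w0) * ((p n - p0) * S n \<omega>)) (0 + 0 + 0 + 0 + 0 + 0)"
    by (intro conv_in_prob_add conv_in_prob_cmult D1 D2 conv_in_prob_mult_zero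
        conv_in_prob_mult_l2_bounded Q w' p' q' S B)
  then show ?thesis by (simp add: algebra_simps)
qed

section \<open>The false positive rate\<close>

lemma fpr_estimator_measurable:
  assumes "\<And>i. i \<in> A \<Longrightarrow> R i \<in> borel_measurable M" "\<And>i. i \<in> A \<Longrightarrow> G i \<in> borel_measurable M"
  shows "fpr_estimator \<alpha> A R G \<in> borel_measurable M"
  unfolding fpr_estimator_def
  by (intro borel_measurable_divide borel_measurable_sum borel_measurable_times borel_measurable_diff
      measurable_compose[OF assms(1)] assms) auto

text \<open>This is the summand of \<open>ratio_linearization\<close>: numerator minus quotient
  times denominator, over the expected denominator. Its mean is visibly 0.\<close>

lemma fpr_influence_eq:
  assumes "(\<integral>\<omega>. 1 - G \<omega> \<partial>M) \<noteq> 0"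
  shows "fpr_influence M \<alpha> R G (r, g) =
    (indicator {\<alpha><..} r * (1 - g) - fpr_param M \<alpha> R G * (1 - g)) / (\<integral>\<omega>. 1 - G \<omega> \<partial>M)"
  using assms by (simp add: fpr_influence_def fpr_param_def field_simps power2_eq_square)

lemma fpr_influence_measurable: "fpr_influence M \<alpha> R G \<in> borel_measurable borel"
  unfolding fpr_influence_def split_beta borel_prod[symmetric] by measurable

text \<open>The influence function is \<open>1 - G\<close> times a bounded factor, because an
  indicator minus \<theta> is at most \<open>1 + \<bar>\<theta>\<bar>\<close> in size. A second
  moment of \<open>G\<close> thus carries over, even for unbounded predictions.\<close>

lemma fpr_influence_moments:
  assumes [measurable]: "R \<in> borel_measurable M" "G \<in> borel_measurable M"
    and sq: "integrable M (\<lambda>\<omega>. (G \<omega>)\<^sup>2)" and nz: "(\<integral>\<omega>. 1 - G \<omega> \<partial>M) \<noteq> 0"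
  shows "integrable M (\<lambda>\<omega>. (fpr_influence M \<alpha> R G (R \<omega>, G \<omega>))\<^sup>2)"
    and "expectation (\<lambda>\<omega>. fpr_influence M \<alpha> R G (R \<omega>, G \<omega>)) = 0"
proof -
  define \<beta> \<theta> where "\<beta> = (\<integral>\<omega>. 1 - G \<omega> \<partial>M)" and "\<theta> = fpr_param M \<alpha> R G"
  have sq1: "integrable M (\<lambda>\<omega>. (1 - G \<omega>)\<^sup>2)"
    using integrable_square_add[of "\<lambda>_. 1" "\<lambda>\<omega>. - G \<omega>"] sq by simp
  have int1: "integrable M (\<lambda>\<omega>. 1 - G \<omega>)"
    by (rule square_integrable_imp_integrable[OF _ sq1]) simp
  have int2: "integrable M (\<lambda>\<omega>. indicator {\<alpha><..} (R \<omega>) * (1 - G \<omega>))"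
    by (rule Bochner_Integration.integrable_bound[OF int1]) (auto simp: indicator_def)
  have eq: "fpr_influence M \<alpha> R G (R \<omega>, G \<omega>)
      = (indicator {\<alpha><..} (R \<omega>) * (1 - G \<omega>) - \<theta> * (1 - G \<omega>)) / \<beta>" for \<omega>
    unfolding fpr_influence_eq[OF nz] \<beta>_def \<theta>_def ..
  have "integrable M (\<lambda>\<omega>. ((1 + \<bar>\<theta>\<bar>) / \<beta>)\<^sup>2 * (1 - G \<omega>)\<^sup>2)"
    using sq1 by simp
  then show "integrable M (\<lambda>\<omega>. (fpr_influence M \<alpha> R G (R \<omega>, G \<omega>))\<^sup>2)"
  proof (rule Bochner_Integration.integrable_bound)
    show "AE \<omega> in M. norm ((fpr_influence M \<alpha> R G (R \<omega>, G \<omega>))\<^sup>2) \<le> norm (((1 + \<bar>\<theta>\<bar>) / \<beta>)\<^sup>2 * (1 - G \<omega>)\<^sup>2)"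
    proof (rule AE_I2)
      fix \<omega>
      have "fpr_influence M \<alpha> R G (R \<omega>, G \<omega>) = (indicator {\<alpha><..} (R \<omega>) - \<theta>) / \<beta> * (1 - G \<omega>)"
        unfolding eq by (simp add: algebra_simps)
      moreover have "((indicator {\<alpha><..} (R \<omega>) - \<theta>) / \<beta>)\<^sup>2 \<le> ((1 + \<bar>\<theta>\<bar>) / \<beta>)\<^sup>2"
        unfolding power_divide
        by (intro divide_right_mono) (auto simp: abs_le_square_iff[symmetric] indicator_def)
      ultimately show "norm ((fpr_influence M \<alpha> R G (R \<omega>, G \<omega>))\<^sup>2) \<le> norm (((1 + \<bar>\<theta>\<bar>) / \<beta>)\<^sup>2 * (1 - G \<omega>)\<^sup>2)"
        by (simp only: power_mult_distrib real_norm_def abs_mult abs_power2 mult_right_mono zero_le_power2)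
    qed
  qed (unfold eq, measurable)
  have "expectation (\<lambda>\<omega>. fpr_influence M \<alpha> R G (R \<omega>, G \<omega>))
      = ((\<integral>\<omega>. indicator {\<alpha><..} (R \<omega>) * (1 - G \<omega>) \<partial>M) - \<theta> * \<beta>) / \<beta>"
    unfolding eq using int1 int2 by (simp add: \<beta>_def)
  also have "\<dots> = 0"
    using nz by (simp add: \<theta>_def \<beta>_def fpr_param_def)
  finally show "expectation (\<lambda>\<omega>. fpr_influence M \<alpha> R G (R \<omega>, G \<omega>)) = 0" .
qed

text \<open>Mean-square bounds, and not i.i.d. assumptions, are the hypotheses, so that the labeled
  block and the pooled sample are treated alike.\<close>

lemma fpr_estimator_linear:
  fixes Rs Gs :: "nat \<Rightarrow> nat \<Rightarrow> 'a \<Rightarrow> real" and A :: "nat \<Rightarrow> nat set"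
  assumes card: "filterlim (\<lambda>n. card (A n)) at_top sequentially"
    and R: "\<And>n i. i \<in> A n \<Longrightarrow> Rs n i \<in> borel_measurable M"
    and G: "\<And>n i. i \<in> A n \<Longrightarrow> Gs n i \<in> borel_measurable M"
    and nz: "(\<integral>\<omega>. 1 - G \<omega> \<partial>M) \<noteq> 0"
    and "l2_bounded M (\<lambda>n \<omega>. (\<Sum>i\<in>A n. fpr_influence M \<alpha> R G (Rs n i \<omega>, Gs n i \<omega>)) / sqrt (real (card (A n))))"
    and "l2_bounded M (\<lambda>n \<omega>. (\<Sum>i\<in>A n. 1 - Gs n i \<omega> - (\<integral>\<omega>. 1 - G \<omega> \<partial>M)) / sqrt (real (card (A n))))"
  shows "conv_in_prob M (\<lambda>n \<omega>. sqrt (real (card (A n))) *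
    (fpr_estimator \<alpha> (A n) (Rs n) (Gs n) \<omega> - fpr_param M \<alpha> R G
      - 1 / real (card (A n)) * (\<Sum>i\<in>A n. fpr_influence M \<alpha> R G (Rs n i \<omega>, Gs n i \<omega>)))) 0"
proof -
  have "conv_in_prob M (\<lambda>n \<omega>. sqrt (real (card (A n))) *
    ((\<Sum>i\<in>A n. indicator {\<alpha><..} (Rs n i \<omega>) * (1 - Gs n i \<omega>)) / (\<Sum>i\<in>A n. 1 - Gs n i \<omega>) - fpr_param M \<alpha> R G
      - 1 / real (card (A n)) * (\<Sum>i\<in>A n. (indicator {\<alpha><..} (Rs n i \<omega>) * (1 - Gs n i \<omega>)
        - fpr_param M \<alpha> R G * (1 - Gs n i \<omega>)) / (\<integral>\<omega>. 1 - G \<omega> \<partial>M)))) 0"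
  proof (rule ratio_linearization[OF card _ _ nz])
    show "(\<lambda>\<omega>. indicator {\<alpha><..} (Rs n i \<omega>) * (1 - Gs n i \<omega>)) \<in> borel_measurable M"
      "(\<lambda>\<omega>. 1 - Gs n i \<omega>) \<in> borel_measurable M" if "i \<in> A n" for n i
      using R[OF that] G[OF that] by measurable
  qed (use assms(5,6) in \<open>simp_all only: fpr_influence_eq[OF nz]\<close>)
  then show ?thesis by (simp only: fpr_influence_eq[OF nz] fpr_estimator_def)
qed

text \<open>Almost surely \<open>1 - Y\<close> is the indicator of \<open>Y = 0\<close>, which turns
  the quotient of integrals into an elementary conditional probability. The second claim shows when
  the denominator is nonzero.\<close>

lemma fpr_cond_prob_eq:
  assumes [measurable]: "R \<in> borel_measurable M" "Y \<in> borel_measurable M"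
    and Y: "AE \<omega> in M. Y \<omega> \<in> {0, 1}"
  shows "\<P>(\<omega> in M. R \<omega> > \<alpha> \<bar> Y \<omega> = 0) = fpr_param M \<alpha> R Y"
    and "(\<integral>\<omega>. 1 - Y \<omega> \<partial>M) = 1 - \<P>(\<omega> in M. Y \<omega> = 1)"
proof -
  have 1: "(\<integral>\<omega>. indicator {\<alpha><..} (R \<omega>) * (1 - Y \<omega>) \<partial>M)
      = (\<integral>\<omega>. indicator {\<omega> \<in> space M. R \<omega> > \<alpha> \<and> Y \<omega> = 0} \<omega> \<partial>M)"
  proof (rule integral_cong_AE)
    show "AE \<omega> in M. indicator {\<alpha><..} (R \<omega>) * (1 - Y \<omega>)
        = (indicator {\<omega> \<in> space M. R \<omega> > \<alpha> \<and> Y \<omega> = 0} \<omega> :: real)"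
      using Y AE_space by eventually_elim (auto simp: indicator_def)
  qed measurable
  have 2: "(\<integral>\<omega>. 1 - Y \<omega> \<partial>M) = (\<integral>\<omega>. indicator {\<omega> \<in> space M. Y \<omega> = 0} \<omega> \<partial>M)"
  proof (rule integral_cong_AE)
    show "AE \<omega> in M. 1 - Y \<omega> = (indicator {\<omega> \<in> space M. Y \<omega> = 0} \<omega> :: real)"
      using Y AE_space by eventually_elim (auto simp: indicator_def)
  qed measurable
  show "\<P>(\<omega> in M. R \<omega> > \<alpha> \<bar> Y \<omega> = 0) = fpr_param M \<alpha> R Y"
    unfolding fpr_param_def 1 2 by (simp add: cond_prob_def)
  have 3: "\<P>(\<omega> in M. Y \<omega> = 0) = \<P>(\<omega> in M. \<not> Y \<omega> = 1)"
  proof (rule finite_measure_eq_AE)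
    show "AE \<omega> in M. (\<omega> \<in> {\<omega> \<in> space M. Y \<omega> = 0}) = (\<omega> \<in> {\<omega> \<in> space M. \<not> Y \<omega> = 1})"
      using Y by eventually_elim auto
  qed measurable
  show "(\<integral>\<omega>. 1 - Y \<omega> \<partial>M) = 1 - \<P>(\<omega> in M. Y \<omega> = 1)"
    unfolding 2 using prob_neg[of "\<lambda>\<omega>. Y \<omega> = 1"] 3 by simp
qed

text \<open>Supplies the moment hypotheses of \<open>l2_bounded_iid_sum\<close> for the denominators
  of the ratios.\<close>

lemma centered_complement_moments:
  fixes G :: "'a \<Rightarrow> real"
  assumes [measurable]: "G \<in> borel_measurable M" and G2: "integrable M (\<lambda>\<omega>. (G \<omega>)\<^sup>2)"
  shows "integrable M (\<lambda>\<omega>. (1 - G \<omega> - (\<integral>\<omega>. 1 - G \<omega> \<partial>M))\<^sup>2)"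
    and "expectation (\<lambda>\<omega>. 1 - G \<omega> - (\<integral>\<omega>. 1 - G \<omega> \<partial>M)) = 0"
proof -
  have "integrable M (\<lambda>\<omega>. ((1 - (\<integral>\<omega>. 1 - G \<omega> \<partial>M)) + - G \<omega>)\<^sup>2)"
    using G2 by (intro integrable_square_add) simp_all
  then show "integrable M (\<lambda>\<omega>. (1 - G \<omega> - (\<integral>\<omega>. 1 - G \<omega> \<partial>M))\<^sup>2)"
    by (simp add: algebra_simps)
  have "integrable M G"
    by (rule square_integrable_imp_integrable[OF _ G2]) simp
  then show "expectation (\<lambda>\<omega>. 1 - G \<omega> - (\<integral>\<omega>. 1 - G \<omega> \<partial>M)) = 0"
    by (simp add: prob_space)
qed

text \<open>Outcome and prediction enter on equal terms, through a second moment and a nonzero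
  expected complement; the binary outcome and the covariate vector are left to the theorem that
  follows.\<close>

lemma fpr_prediction_powered:
  fixes R F Y :: "'a \<Rightarrow> real" and Rs Fs Ys :: "nat \<Rightarrow> nat \<Rightarrow> 'a \<Rightarrow> real" and N :: "nat \<Rightarrow> nat"
    and \<alpha> :: real
  defines "\<phi>Y \<equiv> fpr_influence M \<alpha> R Y" and "\<phi>f \<equiv> fpr_influence M \<alpha> R F"
    and "\<theta>hat \<equiv> \<lambda>n. fpr_estimator \<alpha> {1..n} (Rs n) (Ys n)"
    and "\<theta>hatf \<equiv> \<lambda>n. fpr_estimator \<alpha> {1..n} (Rs n) (Fs n)"
    and "\<theta>hatfN \<equiv> \<lambda>n. fpr_estimator \<alpha> {1..n + N n} (Rs n) (Fs n)"
    and "\<theta>0 \<equiv> fpr_param M \<alpha> R Y"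
  assumes R [measurable]: "R \<in> borel_measurable M" and F [measurable]: "F \<in> borel_measurable M"
    and Y [measurable]: "Y \<in> borel_measurable M"
    and F2: "integrable M (\<lambda>\<omega>. (F \<omega>)\<^sup>2)" and Y2: "integrable M (\<lambda>\<omega>. (Y \<omega>)\<^sup>2)"
    and nzF: "(\<integral>\<omega>. 1 - F \<omega> \<partial>M) \<noteq> 0" and nzY: "(\<integral>\<omega>. 1 - Y \<omega> \<partial>M) \<noteq> 0"
    and pos: "0 < (\<integral>\<omega>. (\<phi>f (R \<omega>, F \<omega>))\<^sup>2 \<partial>M)"
    and Rs: "\<And>n i. i \<in> {1..n + N n} \<Longrightarrow> Rs n i \<in> borel_measurable M"
    and Fs: "\<And>n i. i \<in> {1..n + N n} \<Longrightarrow> Fs n i \<in> borel_measurable M"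
    and labeled_indep: "\<And>n. indep_vars (\<lambda>_. borel) (\<lambda>i \<omega>. (Rs n i \<omega>, Fs n i \<omega>, Ys n i \<omega>)) {1..n}"
    and labeled_copies: "\<And>n i. i \<in> {1..n} \<Longrightarrow>
           distr M borel (\<lambda>\<omega>. (Rs n i \<omega>, Fs n i \<omega>, Ys n i \<omega>)) = distr M borel (\<lambda>\<omega>. (R \<omega>, F \<omega>, Y \<omega>))"
    and unlabeled_indep: "\<And>n. indep_vars (\<lambda>_. borel) (\<lambda>i \<omega>. (Rs n i \<omega>, Fs n i \<omega>)) {n + 1..n + N n}"
    and unlabeled_copies: "\<And>n i. i \<in> {n + 1..n + N n} \<Longrightarrow>
           distr M borel (\<lambda>\<omega>. (Rs n i \<omega>, Fs n i \<omega>)) = distr M borel (\<lambda>\<omega>. (R \<omega>, F \<omega>))"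
    and labeled_unlabeled_indep: "\<And>n. indep_rvs M
           (PiM {1..n} (\<lambda>_. borel)) (\<lambda>\<omega>. \<lambda>i\<in>{1..n}. (Rs n i \<omega>, Fs n i \<omega>, Ys n i \<omega>))
           (PiM {n + 1..n + N n} (\<lambda>_. borel)) (\<lambda>\<omega>. \<lambda>i\<in>{n + 1..n + N n}. (Rs n i \<omega>, Fs n i \<omega>))"
    and N_top: "filterlim N at_top sequentially"
  shows asymptotically_linear_labeled:
      "asymptotically_linear M (\<lambda>n i \<omega>. (Rs n i \<omega>, Ys n i \<omega>)) \<theta>hat \<theta>0 \<phi>Y"
    and asymptotically_linear_predicted:
      "asymptotically_linear M (\<lambda>n i \<omega>. (Rs n i \<omega>, Fs n i \<omega>)) \<theta>hatf (fpr_param M \<alpha> R F) \<phi>f"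
    and prediction_powered_clt:
      "0 \<le> lam \<Longrightarrow> (\<lambda>n. real n / real (N n)) \<longlonglongrightarrow> lam \<Longrightarrow>
       conv_in_prob M w ((\<integral>\<omega>. \<phi>Y (R \<omega>, Y \<omega>) * \<phi>f (R \<omega>, F \<omega>) \<partial>M) / (\<integral>\<omega>. (\<phi>f (R \<omega>, F \<omega>))\<^sup>2 \<partial>M)) \<Longrightarrow>
       weak_conv_m
         (\<lambda>n. distr M borel (\<lambda>\<omega>. sqrt (real n) *
            (\<theta>hat n \<omega> + w n \<omega> * (\<theta>hatfN n \<omega> - \<theta>hatf n \<omega>) - \<theta>0)))
         (normal_law 0
            ((\<integral>\<omega>. (\<phi>Y (R \<omega>, Y \<omega>))\<^sup>2 \<partial>M)
             - (\<integral>\<omega>. \<phi>Y (R \<omega>, Y \<omega>) * \<phi>f (R \<omega>, F \<omega>) \<partial>M)\<^sup>2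
               / ((1 + lam) * (\<integral>\<omega>. (\<phi>f (R \<omega>, F \<omega>))\<^sup>2 \<partial>M))))"
proof -

  \<comment> \<open>Mean-square bounds and the linear expansions\<close>
  define \<beta>Y \<beta>f where "\<beta>Y = (\<integral>\<omega>. 1 - Y \<omega> \<partial>M)" and "\<beta>f = (\<integral>\<omega>. 1 - F \<omega> \<partial>M)"
  have \<phi>_meas [measurable]: "\<phi>Y \<in> borel_measurable (borel \<Otimes>\<^sub>M borel)" "\<phi>f \<in> borel_measurable (borel \<Otimes>\<^sub>M borel)"
    unfolding \<phi>Y_def \<phi>f_def borel_prod by (rule fpr_influence_measurable)+
  note momY = fpr_influence_moments[OF R Y Y2 nzY, of \<alpha>, folded \<phi>Y_def]
  note momf = fpr_influence_moments[OF R F F2 nzF, of \<alpha>, folded \<phi>f_def]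
  have T3: "(\<lambda>\<omega>. (R \<omega>, F \<omega>, Y \<omega>)) \<in> measurable M borel"
    unfolding borel_prod[symmetric] by measurable
  have T2: "(\<lambda>\<omega>. (R \<omega>, F \<omega>)) \<in> measurable M borel"
    unfolding borel_prod[symmetric] by measurable
  have card_n: "filterlim (\<lambda>n. card {1..n}) at_top sequentially"
    by (simp add: filterlim_ident)
  have card_N: "filterlim (\<lambda>n. card {n + 1..n + N n}) at_top sequentially"
    using N_top by simp
  have card_nN: "filterlim (\<lambda>n. card {1..n + N n}) at_top sequentially"
    using filterlim_at_top_mono[OF N_top, of "\<lambda>n. n + N n"] by simp
  define SY Sf B where
    "SY = (\<lambda>n \<omega>. (\<Sum>i\<in>{1..n}. \<phi>Y (Rs n i \<omega>, Ys n i \<omega>)) / sqrt (real (card {1..n})))" and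
    "Sf = (\<lambda>n \<omega>. (\<Sum>i\<in>{1..n}. \<phi>f (Rs n i \<omega>, Fs n i \<omega>)) / sqrt (real (card {1..n})))" and
    "B = (\<lambda>n \<omega>. (\<Sum>i\<in>{n + 1..n + N n}. \<phi>f (Rs n i \<omega>, Fs n i \<omega>)) / sqrt (real (card {n + 1..n + N n})))"
  \<comment> \<open>Both labeled sums are read as functions of the same triple, so that they can
    later be merged into one i.i.d. sum.\<close>
  have SY: "l2_bounded M SY"
    using l2_bounded_iid_sum[OF _ T3 _ labeled_indep labeled_copies, of "\<lambda>(r, f, y). \<phi>Y (r, y)"] momY
    unfolding SY_def by (simp add: borel_prod[symmetric])
  have Sf: "l2_bounded M Sf"
    using l2_bounded_iid_sum[OF _ T3 _ labeled_indep labeled_copies, of "\<lambda>(r, f, y). \<phi>f (r, f)"] momf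
    unfolding Sf_def by (simp add: borel_prod[symmetric])
  have B: "l2_bounded M B"
    using l2_bounded_iid_sum[OF _ T2 _ unlabeled_indep unlabeled_copies, of \<phi>f] momf
    unfolding B_def by (simp add: borel_prod[symmetric])
  have bY: "l2_bounded M (\<lambda>n \<omega>. (\<Sum>i\<in>{1..n}. 1 - Ys n i \<omega> - \<beta>Y) / sqrt (real (card {1..n})))"
    using l2_bounded_iid_sum[OF _ T3 _ labeled_indep labeled_copies, of "\<lambda>(r, f, y). 1 - y - \<beta>Y"] centered_complement_moments[OF Y Y2]
    by (simp add: borel_prod[symmetric] \<beta>Y_def)
  have bf: "l2_bounded M (\<lambda>n \<omega>. (\<Sum>i\<in>{1..n}. 1 - Fs n i \<omega> - \<beta>f) / sqrt (real (card {1..n})))"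
    using l2_bounded_iid_sum[OF _ T3 _ labeled_indep labeled_copies, of "\<lambda>(r, f, y). 1 - f - \<beta>f"] centered_complement_moments[OF F F2]
    by (simp add: borel_prod[symmetric] \<beta>f_def)
  have bu: "l2_bounded M (\<lambda>n \<omega>. (\<Sum>i\<in>{n + 1..n + N n}. 1 - Fs n i \<omega> - \<beta>f) / sqrt (real (card {n + 1..n + N n})))"
    using l2_bounded_iid_sum[OF _ T2 _ unlabeled_indep unlabeled_copies, of "\<lambda>(r, f). 1 - f - \<beta>f"] centered_complement_moments[OF F F2]
    by (simp add: borel_prod[symmetric] \<beta>f_def)
  have union: "{1..n} \<union> {n + 1..n + N n} = {1..n + N n}" for n by auto
  have SfN: "l2_bounded M (\<lambda>n \<omega>. (\<Sum>i\<in>{1..n + N n}. \<phi>f (Rs n i \<omega>, Fs n i \<omega>)) / sqrt (real (card {1..n + N n})))"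
    using l2_bounded_union_sum[OF _ _ _ Sf[unfolded Sf_def] B[unfolded B_def]] by (simp only: union) auto
  have bfN: "l2_bounded M (\<lambda>n \<omega>. (\<Sum>i\<in>{1..n + N n}. 1 - Fs n i \<omega> - \<beta>f) / sqrt (real (card {1..n + N n})))"
    using l2_bounded_union_sum[OF _ _ _ bf bu] by (simp only: union) auto
  \<comment> \<open>Measurability of the labels is contained in the independence of the triples,
    from which it is projected out.\<close>
  have Ys: "Ys n i \<in> borel_measurable M" if "i \<in> {1..n}" for n i
  proof -
    have "(\<lambda>\<omega>. (Rs n i \<omega>, Fs n i \<omega>, Ys n i \<omega>)) \<in> measurable M borel"
      using labeled_indep[of n] that by (auto simp: indep_vars_def2)
    then have "(\<lambda>\<omega>. (Rs n i \<omega>, Fs n i \<omega>, Ys n i \<omega>)) \<in> measurable M (borel \<Otimes>\<^sub>M borel \<Otimes>\<^sub>M borel)"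
      by (simp add: borel_prod)
    then show ?thesis
      by (auto dest!: measurable_snd' simp: o_def)
  qed
  have linY: "conv_in_prob M (\<lambda>n \<omega>. sqrt (real (card {1..n})) *
    (\<theta>hat n \<omega> - \<theta>0 - 1 / real (card {1..n}) * (\<Sum>i\<in>{1..n}. \<phi>Y (Rs n i \<omega>, Ys n i \<omega>)))) 0"
    unfolding \<theta>hat_def \<theta>0_def \<phi>Y_def
    by (rule fpr_estimator_linear[OF card_n Rs Ys nzY SY[unfolded SY_def \<phi>Y_def] bY[unfolded \<beta>Y_def]]) auto
  have linf: "conv_in_prob M (\<lambda>n \<omega>. sqrt (real (card {1..n})) *
    (\<theta>hatf n \<omega> - fpr_param M \<alpha> R F - 1 / real (card {1..n}) * (\<Sum>i\<in>{1..n}. \<phi>f (Rs n i \<omega>, Fs n i \<omega>)))) 0"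
    unfolding \<theta>hatf_def \<phi>f_def
    by (rule fpr_estimator_linear[OF card_n Rs Fs nzF Sf[unfolded Sf_def \<phi>f_def] bf[unfolded \<beta>f_def]]) auto
  have linfN: "conv_in_prob M (\<lambda>n \<omega>. sqrt (real (card {1..n + N n})) *
    (\<theta>hatfN n \<omega> - fpr_param M \<alpha> R F - 1 / real (card {1..n + N n}) * (\<Sum>i\<in>{1..n + N n}. \<phi>f (Rs n i \<omega>, Fs n i \<omega>)))) 0"
    unfolding \<theta>hatfN_def \<phi>f_def
    by (rule fpr_estimator_linear[OF card_nN Rs Fs nzF SfN[unfolded \<phi>f_def] bfN[unfolded \<beta>f_def]]) auto
  show "asymptotically_linear M (\<lambda>n i \<omega>. (Rs n i \<omega>, Ys n i \<omega>)) \<theta>hat \<theta>0 \<phi>Y"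
    unfolding asymptotically_linear_def small_o_in_prob_root_iff using linY by simp
  show "asymptotically_linear M (\<lambda>n i \<omega>. (Rs n i \<omega>, Fs n i \<omega>)) \<theta>hatf (fpr_param M \<alpha> R F) \<phi>f"
    unfolding asymptotically_linear_def small_o_in_prob_root_iff using linf by simp

  \<comment> \<open>First-order expansion of the prediction-powered estimator\<close>
  define s C where "s = (\<integral>\<omega>. (\<phi>f (R \<omega>, F \<omega>))\<^sup>2 \<partial>M)" and "C = (\<integral>\<omega>. \<phi>Y (R \<omega>, Y \<omega>) * \<phi>f (R \<omega>, F \<omega>) \<partial>M)"
  assume lam: "0 \<le> lam" and lim: "(\<lambda>n. real n / real (N n)) \<longlonglongrightarrow> lam"
    and w: "conv_in_prob M w ((\<integral>\<omega>. \<phi>Y (R \<omega>, Y \<omega>) * \<phi>f (R \<omega>, F \<omega>) \<partial>M) / (\<integral>\<omega>. (\<phi>f (R \<omega>, F \<omega>))\<^sup>2 \<partial>M))"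
  define w0 p0 q0 where "w0 = C / s" and "p0 = 1 / (1 + lam)" and "q0 = sqrt lam / (1 + lam)"
  note w = w[folded s_def C_def, folded w0_def]
  define D1 where "D1 = (\<lambda>n \<omega>. sqrt (real n) *
    (\<theta>hat n \<omega> - \<theta>0 - 1 / real n * (\<Sum>i\<in>{1..n}. \<phi>Y (Rs n i \<omega>, Ys n i \<omega>))))"
  define D2 where "D2 = (\<lambda>n \<omega>. sqrt (real n) *
    (\<theta>hatf n \<omega> - fpr_param M \<alpha> R F - 1 / real n * (\<Sum>i\<in>{1..n}. \<phi>f (Rs n i \<omega>, Fs n i \<omega>))))"
  define D3 where "D3 = (\<lambda>n \<omega>. sqrt (real n) *
    (\<theta>hatfN n \<omega> - fpr_param M \<alpha> R F - 1 / real (n + N n) * (\<Sum>i\<in>{1..n + N n}. \<phi>f (Rs n i \<omega>, Fs n i \<omega>))))"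
  have D1: "conv_in_prob M D1 0" and D2: "conv_in_prob M D2 0"
    using linY linf by (simp_all add: D1_def D2_def)
  have \<theta>_meas: "\<theta>hat n \<in> borel_measurable M" "\<theta>hatf n \<in> borel_measurable M" "\<theta>hatfN n \<in> borel_measurable M" for n
    unfolding \<theta>hat_def \<theta>hatf_def \<theta>hatfN_def
    by (rule fpr_estimator_measurable; use Rs Fs Ys in auto)+
  have sum_meas: "(\<lambda>\<omega>. \<Sum>i\<in>{1..n + N n}. \<phi>f (Rs n i \<omega>, Fs n i \<omega>)) \<in> borel_measurable M" for n
    using Rs Fs by (intro borel_measurable_sum) measurable
  \<comment> \<open>\<open>linfN\<close> carries the larger factor \<open>sqrt (n + N n)\<close>;
    replacing it by \<open>sqrt n\<close> only shrinks the remainder.\<close>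
  have D3: "conv_in_prob M D3 0"
  proof (rule conv_in_prob_dominated[OF linfN, where C = 1])
    show "D3 n \<in> borel_measurable M" for n
      unfolding D3_def using \<theta>_meas sum_meas by measurable
    show "\<bar>D3 n \<omega>\<bar> \<le> 1 * \<bar>sqrt (real (card {1..n + N n})) *
      (\<theta>hatfN n \<omega> - fpr_param M \<alpha> R F - 1 / real (card {1..n + N n}) * (\<Sum>i\<in>{1..n + N n}. \<phi>f (Rs n i \<omega>, Fs n i \<omega>)))\<bar>" for n \<omega>
      unfolding D3_def abs_mult by (auto intro!: mult_right_mono)
  qed
  \<comment> \<open>In this difference the common center \<open>fpr_param M \<alpha> R F\<close>
    cancels; hence the predictions may be centered away from \<theta>0 without introducing a
    bias.\<close>
  have D: "conv_in_prob M (\<lambda>n \<omega>. D3 n \<omega> + (- 1) * D2 n \<omega>) (0 + 0)"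
    by (intro conv_in_prob_add conv_in_prob_cmult D2 D3)
  define p q where "p = (\<lambda>n. real (N n) / (real n + real (N n)))"
    and "q = (\<lambda>n. sqrt (real n) * sqrt (real (N n)) / (real n + real (N n)))"
  have N_pos: "\<forall>\<^sub>F n in sequentially. 0 < N n"
    by (rule eventually_compose_filterlim[OF eventually_gt_at_top N_top])
  have p: "p \<longlonglongrightarrow> p0"
  proof (rule Lim_transform_eventually)
    \<comment> \<open>Dividing numerator and denominator by \<open>N n\<close> expresses the
      coefficient through the ratio whose limit is given; \<open>q\<close> is treated in the same
      way.\<close>
    show "(\<lambda>n. 1 / (1 + real n / real (N n))) \<longlonglongrightarrow> p0"
      unfolding p0_def using lam by (intro tendsto_intros lim) auto
    show "\<forall>\<^sub>F n in sequentially. 1 / (1 + real n / real (N n)) = p n"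
      using N_pos by eventually_elim (simp add: p_def field_simps)
  qed
  have q: "q \<longlonglongrightarrow> q0"
  proof (rule Lim_transform_eventually)
    show "(\<lambda>n. sqrt (real n / real (N n)) / (1 + real n / real (N n))) \<longlonglongrightarrow> q0"
      unfolding q0_def using lam by (intro tendsto_intros lim) auto
    show "\<forall>\<^sub>F n in sequentially. sqrt (real n / real (N n)) / (1 + real n / real (N n)) = q n"
      using N_pos
    proof eventually_elim
      case (elim n)
      define r where "r = sqrt (real (N n))"
      have r: "0 < r" "real (N n) = r * r" using elim by (simp_all add: r_def)
      show ?case
        unfolding q_def real_sqrt_divide r_def[symmetric] r(2) using r(1) by (simp add: field_simps)
    qed
  qed
  define L where "L = (\<lambda>n \<omega>. (SY n \<omega> - w0 * p0 * Sf n \<omega>) + w0 * q0 * B n \<omega>)"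
  define U where "U = (\<lambda>n \<omega>. sqrt (real n) * (\<theta>hat n \<omega> + w n \<omega> * (\<theta>hatfN n \<omega> - \<theta>hatf n \<omega>) - \<theta>0))"
  have meas [measurable]: "SY n \<in> borel_measurable M" "Sf n \<in> borel_measurable M" "B n \<in> borel_measurable M"
      "w n \<in> borel_measurable M" for n
    using SY Sf B w by (auto intro: l2_bounded_measurable conv_in_prob_measurable)
  have L_meas: "L n \<in> borel_measurable M" for n
    unfolding L_def by measurable
  have U_meas: "U n \<in> borel_measurable M" for n
    unfolding U_def using \<theta>_meas by measurable
  have diff: "conv_in_prob M (\<lambda>n \<omega>. U n \<omega> - L n \<omega>) 0"
  proof (rule conv_in_prob_cong)
    show "conv_in_prob M (\<lambda>n \<omega>. (D1 n \<omega> + SY n \<omega> + w n \<omega> * ((D3 n \<omega> + (- 1) * D2 n \<omega>) + (q n * B n \<omega> - p n * Sf n \<omega>)))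
     - ((SY n \<omega> - w0 * p0 * Sf n \<omega>) + w0 * q0 * B n \<omega>)) 0"
      using control_variate_expansion[OF D1 _ Sf B meas(1) w p q] D by simp
    show "(\<lambda>\<omega>. U n \<omega> - L n \<omega>) \<in> borel_measurable M" for n
      using U_meas L_meas by measurable
    show "\<forall>\<^sub>F n in sequentially. \<forall>\<omega>\<in>space M.
      (D1 n \<omega> + SY n \<omega> + w n \<omega> * ((D3 n \<omega> + (- 1) * D2 n \<omega>) + (q n * B n \<omega> - p n * Sf n \<omega>)))
       - ((SY n \<omega> - w0 * p0 * Sf n \<omega>) + w0 * q0 * B n \<omega>) = U n \<omega> - L n \<omega>"
      using N_pos eventually_gt_at_top[of 0]
    proof eventually_elim
      case (elim n)
      \<comment> \<open>With the two square roots as variables, the claim becomes an identity of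
        rational functions.\<close>
      define r where "r = sqrt (real (N n))"
      define k where "k = sqrt (real n)"
      have r: "0 < r" "real (N n) = r * r" using elim by (simp_all add: r_def)
      have k: "0 < k" "real n = k * k" using elim by (simp_all add: k_def)
      have nz: "k * k + r * r \<noteq> 0" using r k by (simp add: add_pos_pos less_imp_neq[symmetric])
      show ?case
      proof
        fix \<omega>
        define a where "a = (\<Sum>i\<in>{1..n}. \<phi>f (Rs n i \<omega>, Fs n i \<omega>))"
        define b where "b = (\<Sum>i\<in>{n + 1..n + N n}. \<phi>f (Rs n i \<omega>, Fs n i \<omega>))"
        define y where "y = (\<Sum>i\<in>{1..n}. \<phi>Y (Rs n i \<omega>, Ys n i \<omega>))"
        have ab: "(\<Sum>i\<in>{1..n + N n}. \<phi>f (Rs n i \<omega>, Fs n i \<omega>)) = a + b"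
          unfolding a_def b_def union[symmetric] by (rule sum.union_disjoint) auto
        have 1: "D1 n \<omega> + SY n \<omega> = k * (\<theta>hat n \<omega> - \<theta>0)"
          unfolding D1_def SY_def y_def[symmetric] card_atLeastAtMost
          using k by (simp add: k_def[symmetric] field_simps)
        have 2: "D3 n \<omega> + (- 1) * D2 n \<omega> + (q n * B n \<omega> - p n * Sf n \<omega>) = k * (\<theta>hatfN n \<omega> - \<theta>hatf n \<omega>)"
        proof -
          \<comment> \<open>The coefficient of \<open>a\<close> is
            \<open>k / (k * k + r * r) - 1 / k\<close>, in which the numerators cancel down to
            \<open>- r * r\<close>; this is where the labeled sum acquires its negative
            sign.\<close>
          have "k * (1 / (k * k + r * r) * (a + b)) - k * (1 / (k * k) * a) = k * r / (k * k + r * r) * (b / r) - r * r / (k * k + r * r) * (a / k)"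
            using r(1) k(1) nz by (simp add: divide_simps) (simp add: algebra_simps)
          moreover have "D3 n \<omega> = k * (\<theta>hatfN n \<omega> - fpr_param M \<alpha> R F) - k * (1 / (k * k + r * r) * (a + b))"
            unfolding D3_def ab k_def[symmetric] of_nat_add unfolding k(2) r(2) by (simp add: algebra_simps)
          moreover have "D2 n \<omega> = k * (\<theta>hatf n \<omega> - fpr_param M \<alpha> R F) - k * (1 / (k * k) * a)"
            unfolding D2_def a_def[symmetric] k_def[symmetric] unfolding k(2) by (simp add: algebra_simps)
          moreover have "q n = k * r / (k * k + r * r)" "p n = r * r / (k * k + r * r)"
            unfolding p_def q_def k_def[symmetric] r_def[symmetric] unfolding k(2) r(2) by simp_all
          moreover have "B n \<omega> = b / r" "Sf n \<omega> = a / k"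
            unfolding B_def Sf_def a_def b_def k_def r_def by simp_all
          ultimately show ?thesis by (simp only:) (simp add: algebra_simps)
        qed
        have "(D1 n \<omega> + SY n \<omega> + w n \<omega> * ((D3 n \<omega> + (- 1) * D2 n \<omega>) + (q n * B n \<omega> - p n * Sf n \<omega>)))
            = U n \<omega>"
          unfolding 1 2 U_def k_def[symmetric] by (simp add: algebra_simps)
        then show "(D1 n \<omega> + SY n \<omega> + w n \<omega> * ((D3 n \<omega> + (- 1) * D2 n \<omega>) + (q n * B n \<omega> - p n * Sf n \<omega>)))
       - ((SY n \<omega> - w0 * p0 * Sf n \<omega>) + w0 * q0 * B n \<omega>) = U n \<omega> - L n \<omega>"
          by (simp only: L_def)
      qed
    qed
  qed

  \<comment> \<open>Independent blocks, the limit variance and the Gaussian limit\<close>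
  define h where "h = (\<lambda>(r, f, y). \<phi>Y (r, y) - w0 * p0 * \<phi>f (r, f))"
  have h_meas [measurable]: "h \<in> borel_measurable (borel \<Otimes>\<^sub>M borel \<Otimes>\<^sub>M borel)"
    unfolding h_def split_beta by measurable
  have h: "h \<in> borel_measurable borel" using h_meas by (simp add: borel_prod)
  have \<phi>f_borel: "\<phi>f \<in> borel_measurable borel" using \<phi>_meas by (simp add: borel_prod)
  have intYf: "integrable M (\<lambda>\<omega>. \<phi>Y (R \<omega>, Y \<omega>) * \<phi>f (R \<omega>, F \<omega>))"
    by (rule integrable_mult_square) (use momY momf in measurable)
  have intY: "integrable M (\<lambda>\<omega>. \<phi>Y (R \<omega>, Y \<omega>))" and intf: "integrable M (\<lambda>\<omega>. \<phi>f (R \<omega>, F \<omega>))"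
    by (rule square_integrable_imp_integrable[OF _ momY(1)], measurable)
       (rule square_integrable_imp_integrable[OF _ momf(1)], measurable)
  define sY where "sY = (\<integral>\<omega>. (\<phi>Y (R \<omega>, Y \<omega>))\<^sup>2 \<partial>M)"
  have h_sq: "(h (R \<omega>, F \<omega>, Y \<omega>))\<^sup>2 = (\<phi>Y (R \<omega>, Y \<omega>))\<^sup>2 + (w0 * p0)\<^sup>2 * (\<phi>f (R \<omega>, F \<omega>))\<^sup>2
      - 2 * (w0 * p0) * (\<phi>Y (R \<omega>, Y \<omega>) * \<phi>f (R \<omega>, F \<omega>))" for \<omega>
    by (simp add: h_def power2_diff power_mult_distrib)
  have h2: "integrable M (\<lambda>\<omega>. (h (R \<omega>, F \<omega>, Y \<omega>))\<^sup>2)"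
    unfolding h_sq using momY(1) momf(1) intYf by simp
  have h_var: "expectation (\<lambda>\<omega>. (h (R \<omega>, F \<omega>, Y \<omega>))\<^sup>2) = sY + (w0 * p0)\<^sup>2 * s - 2 * (w0 * p0) * C"
    unfolding h_sq using momY(1) momf(1) intYf by (simp add: sY_def s_def C_def)
  have h_mean: "expectation (\<lambda>\<omega>. h (R \<omega>, F \<omega>, Y \<omega>)) = 0"
    using intY intf momY(2) momf(2) by (simp add: h_def)
  define HS where "HS = (\<lambda>n \<omega>. (\<Sum>i\<in>{1..n}. h (Rs n i \<omega>, Fs n i \<omega>, Ys n i \<omega>)) / sqrt (real (card {1..n})))"
  \<comment> \<open>The two labeled sums are dependent, but together they form one i.i.d. sum with
    score \<open>h\<close>; their correlation enters only through the second moment of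
    \<open>h\<close>, as the term in \<open>C\<close>.\<close>
  have HS: "(\<lambda>\<omega>. SY n \<omega> - w0 * p0 * Sf n \<omega>) = HS n" for n
    by (simp add: HS_def SY_def Sf_def h_def sum_subtractf diff_divide_distrib sum_distrib_left)
  have indep: "indep_var borel (HS n) borel (\<lambda>\<omega>. w0 * q0 * B n \<omega>)" for n
  proof -
    \<comment> \<open>Each side is written as a function of its whole tuple. Restricting a tuple to
      its index set changes nothing, since the sums run over that set only.\<close>
    have "indep_var borel
       (\<lambda>\<omega>. (\<lambda>u. (\<Sum>i\<in>{1..n}. h (u i)) / sqrt (real (card {1..n}))) (\<lambda>i\<in>{1..n}. (Rs n i \<omega>, Fs n i \<omega>, Ys n i \<omega>)))
       borel
       (\<lambda>\<omega>. (\<lambda>u. w0 * q0 * ((\<Sum>i\<in>{n + 1..n + N n}. \<phi>f (u i)) / sqrt (real (card {n + 1..n + N n}))))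
         (\<lambda>i\<in>{n + 1..n + N n}. (Rs n i \<omega>, Fs n i \<omega>)))"
    proof (rule indep_var_of_indep_rvs[OF labeled_unlabeled_indep])
      show "(\<lambda>u. (\<Sum>i\<in>{1..n}. h (u i)) / sqrt (real (card {1..n}))) \<in> borel_measurable (PiM {1..n} (\<lambda>_. borel))"
        by (intro borel_measurable_divide borel_measurable_sum measurable_compose[OF _ h]
            measurable_component_singleton) auto
      show "(\<lambda>u. w0 * q0 * ((\<Sum>i\<in>{n + 1..n + N n}. \<phi>f (u i)) / sqrt (real (card {n + 1..n + N n}))))
          \<in> borel_measurable (PiM {n + 1..n + N n} (\<lambda>_. borel))"
        by (intro borel_measurable_times borel_measurable_divide borel_measurable_sum
            measurable_compose[OF _ \<phi>f_borel] measurable_component_singleton) auto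
    qed
    moreover have "(\<lambda>\<omega>. (\<lambda>u. (\<Sum>i\<in>{1..n}. h (u i)) / sqrt (real (card {1..n}))) (\<lambda>i\<in>{1..n}. (Rs n i \<omega>, Fs n i \<omega>, Ys n i \<omega>))) = HS n"
      by (auto simp: HS_def intro!: ext sum.cong arg_cong2[where f = "(/)"])
    moreover have "(\<lambda>\<omega>. (\<lambda>u. w0 * q0 * ((\<Sum>i\<in>{n + 1..n + N n}. \<phi>f (u i)) / sqrt (real (card {n + 1..n + N n}))))
         (\<lambda>i\<in>{n + 1..n + N n}. (Rs n i \<omega>, Fs n i \<omega>))) = (\<lambda>\<omega>. w0 * q0 * B n \<omega>)"
      by (auto simp: B_def intro!: ext sum.cong arg_cong2[where f = "(*)"] arg_cong2[where f = "(/)"])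
    ultimately show ?thesis by (simp only:)
  qed
  define v where "v = sY - C\<^sup>2 / ((1 + lam) * s)"
  have s: "0 < s" using pos by (simp add: s_def)
  \<comment> \<open>The two terms in \<open>s\<close> combine by
    \<open>p0\<^sup>2 + q0\<^sup>2 = p0\<close>. Since \<open>w0 = C / s\<close>, they equal
    \<open>w0 * C * p0\<close>, half of the subtracted cross term, and one copy of it
    remains.\<close>
  have v_eq: "v = (sY + (w0 * p0)\<^sup>2 * s - 2 * (w0 * p0) * C) + (w0 * q0)\<^sup>2 * s"
  proof -
    have "p0\<^sup>2 + q0\<^sup>2 = p0"
    proof -
      have "p0\<^sup>2 + q0\<^sup>2 = (1 + lam) / (1 + lam)\<^sup>2"
        using lam by (simp add: p0_def q0_def power_divide add_divide_distrib)
      also have "\<dots> = p0" using lam by (simp add: p0_def power2_eq_square)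
      finally show ?thesis .
    qed
    then have "w0\<^sup>2 * s * (p0\<^sup>2 + q0\<^sup>2) = w0\<^sup>2 * s * p0" by simp
    moreover have "w0\<^sup>2 * s = w0 * C" using s by (simp add: w0_def power2_eq_square)
    moreover have "C\<^sup>2 / ((1 + lam) * s) = w0 * C * p0" by (simp add: w0_def p0_def power2_eq_square)
    ultimately show ?thesis
      by (simp add: v_def power_mult_distrib algebra_simps)
  qed
  \<comment> \<open>The form displayed in the conclusion is a difference; its sign becomes clear
    from the variances of the two independent parts. Nonnegativity makes
    \<open>normal_law 0 v\<close> a probability law, the point mass included.\<close>
  have v_nonneg: "0 \<le> v"
    unfolding v_eq h_var[symmetric] using s by (intro add_nonneg_nonneg) auto
  have L_lim: "(\<lambda>n. char (distr M borel (L n)) t) \<longlonglongrightarrow> complex_of_real (exp (- (v * t\<^sup>2) / 2))" for t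
  proof -
    have H: "(\<lambda>n. char (distr M borel (HS n)) t) \<longlonglongrightarrow>
        complex_of_real (exp (- (t\<^sup>2 * (sY + (w0 * p0)\<^sup>2 * s - 2 * (w0 * p0) * C)) / 2))"
      unfolding HS_def h_var[symmetric]
      by (rule char_iid_sum_tendsto[OF h T3 _ labeled_indep labeled_copies h2 h_mean card_n]) auto
    have "(\<lambda>n. char (distr M borel (B n)) (t * (w0 * q0))) \<longlonglongrightarrow>
        complex_of_real (exp (- ((t * (w0 * q0))\<^sup>2 * s) / 2))"
      unfolding B_def s_def
      by (rule char_iid_sum_tendsto[OF \<phi>f_borel T2 _ unlabeled_indep unlabeled_copies momf card_N]) auto
    then have B': "(\<lambda>n. char (distr M borel (\<lambda>\<omega>. w0 * q0 * B n \<omega>)) t) \<longlonglongrightarrow>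
        complex_of_real (exp (- ((t * (w0 * q0))\<^sup>2 * s) / 2))"
      by (simp only: char_scaled[OF meas(3)])
    have "char (distr M borel (L n)) t = char (distr M borel (HS n)) t * char (distr M borel (\<lambda>\<omega>. w0 * q0 * B n \<omega>)) t" for n
      using char_distr_add[OF indep, of n t] by (simp only: L_def HS[symmetric])
    then have "(\<lambda>n. char (distr M borel (L n)) t) \<longlonglongrightarrow>
        complex_of_real (exp (- (t\<^sup>2 * (sY + (w0 * p0)\<^sup>2 * s - 2 * (w0 * p0) * C)) / 2))
        * complex_of_real (exp (- ((t * (w0 * q0))\<^sup>2 * s) / 2))"
      using tendsto_mult[OF H B'] by (simp only:)
    also have "complex_of_real (exp (- (t\<^sup>2 * (sY + (w0 * p0)\<^sup>2 * s - 2 * (w0 * p0) * C)) / 2))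
        * complex_of_real (exp (- ((t * (w0 * q0))\<^sup>2 * s) / 2)) = complex_of_real (exp (- (v * t\<^sup>2) / 2))"
      unfolding v_eq of_real_mult[symmetric] exp_add[symmetric]
      by (intro arg_cong[where f = complex_of_real] arg_cong[where f = exp])
         (simp add: power_mult_distrib algebra_simps add_divide_distrib diff_divide_distrib)
    finally show ?thesis .
  qed
  have "weak_conv_m (\<lambda>n. distr M borel (U n)) (normal_law 0 v)"
  proof (rule levy_continuity)
    show "real_distribution (distr M borel (U n))" for n
      by (rule real_distribution_distr) (use U_meas in simp)
    show "real_distribution (normal_law 0 v)"
      by (rule real_distribution_normal_law[OF v_nonneg])
    show "(\<lambda>n. char (distr M borel (U n)) t) \<longlonglongrightarrow> char (normal_law 0 v) t" for t
      unfolding char_normal_law_0[OF v_nonneg]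
      by (rule char_tendsto_perturb[OF L_meas U_meas diff L_lim])
  qed
  then show "weak_conv_m
         (\<lambda>n. distr M borel (\<lambda>\<omega>. sqrt (real n) *
            (\<theta>hat n \<omega> + w n \<omega> * (\<theta>hatfN n \<omega> - \<theta>hatf n \<omega>) - \<theta>0)))
         (normal_law 0
            ((\<integral>\<omega>. (\<phi>Y (R \<omega>, Y \<omega>))\<^sup>2 \<partial>M)
             - (\<integral>\<omega>. \<phi>Y (R \<omega>, Y \<omega>) * \<phi>f (R \<omega>, F \<omega>) \<partial>M)\<^sup>2
               / ((1 + lam) * (\<integral>\<omega>. (\<phi>f (R \<omega>, F \<omega>))\<^sup>2 \<partial>M))))"
    unfolding U_def v_def sY_def s_def C_def .
qed

end

section \<open>Covariate vectors and a binary outcome\<close>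

theorem corollary5p1p2:
  fixes M :: "'w measure"
    and X :: "'w \<Rightarrow> real ^ 'd" and Y :: "'w \<Rightarrow> real"
    and j :: 'd and f :: "real ^ 'd \<Rightarrow> real" and \<alpha> :: real
    and Xs :: "nat \<Rightarrow> nat \<Rightarrow> 'w \<Rightarrow> real ^ 'd" and Ys :: "nat \<Rightarrow> nat \<Rightarrow> 'w \<Rightarrow> real"
    and N :: "nat \<Rightarrow> nat"
  defines "R \<equiv> \<lambda>\<omega>. X \<omega> $ j"
    and "F \<equiv> \<lambda>\<omega>. f (X \<omega>)"
    and "Rs \<equiv> \<lambda>n i \<omega>. Xs n i \<omega> $ j"
    and "Fs \<equiv> \<lambda>n i \<omega>. f (Xs n i \<omega>)"
  defines "\<phi>Y \<equiv> fpr_influence M \<alpha> R Y"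
    and "\<phi>f \<equiv> fpr_influence M \<alpha> R F"
    and "\<theta>0 \<equiv> \<P>(\<omega> in M. R \<omega> > \<alpha> \<bar> Y \<omega> = 0)"
    and "\<theta>hat \<equiv> \<lambda>n. fpr_estimator \<alpha> {1..n} (Rs n) (Ys n)"
    and "\<theta>hatf \<equiv> \<lambda>n. fpr_estimator \<alpha> {1..n} (Rs n) (Fs n)"
    and "\<theta>hatfN \<equiv> \<lambda>n. fpr_estimator \<alpha> {1..n + N n} (Rs n) (Fs n)"
  assumes "prob_space M"
    and "X \<in> borel_measurable M" and "Y \<in> borel_measurable M" and "f \<in> borel_measurable borel"
    and "AE \<omega> in M. Y \<omega> \<in> {0, 1}"
    and "0 < \<P>(\<omega> in M. Y \<omega> = 1)" and "\<P>(\<omega> in M. Y \<omega> = 1) < 1"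
    and "AE \<omega> in M. 0 \<le> F \<omega>"
    and "integrable M (\<lambda>\<omega>. (F \<omega>)\<^sup>2)"
    and "(\<integral>\<omega>. F \<omega> \<partial>M) * (1 - (\<integral>\<omega>. F \<omega> \<partial>M)) \<noteq> 0"
    and "0 < (\<integral>\<omega>. (\<phi>f (R \<omega>, F \<omega>))\<^sup>2 \<partial>M)"
    and "\<And>n i. i \<in> {1..n + N n} \<Longrightarrow> Xs n i \<in> borel_measurable M"
    and labeled_indep: "\<And>n. prob_space.indep_vars M (\<lambda>_. borel)
           (\<lambda>i \<omega>. (Rs n i \<omega>, Fs n i \<omega>, Ys n i \<omega>)) {1..n}"
    and labeled_copies: "\<And>n i. i \<in> {1..n} \<Longrightarrow>
           distr M borel (\<lambda>\<omega>. (Rs n i \<omega>, Fs n i \<omega>, Ys n i \<omega>)) = distr M borel (\<lambda>\<omega>. (R \<omega>, F \<omega>, Y \<omega>))"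
    and unlabeled_indep: "\<And>n. prob_space.indep_vars M (\<lambda>_. borel)
           (\<lambda>i \<omega>. (Rs n i \<omega>, Fs n i \<omega>)) {n + 1..n + N n}"
    and unlabeled_copies: "\<And>n i. i \<in> {n + 1..n + N n} \<Longrightarrow>
           distr M borel (\<lambda>\<omega>. (Rs n i \<omega>, Fs n i \<omega>)) = distr M borel (\<lambda>\<omega>. (R \<omega>, F \<omega>))"
    and labeled_unlabeled_indep: "\<And>n. indep_rvs M
           (PiM {1..n} (\<lambda>_. borel)) (\<lambda>\<omega>. \<lambda>i\<in>{1..n}. (Rs n i \<omega>, Fs n i \<omega>, Ys n i \<omega>))
           (PiM {n + 1..n + N n} (\<lambda>_. borel)) (\<lambda>\<omega>. \<lambda>i\<in>{n + 1..n + N n}. (Rs n i \<omega>, Fs n i \<omega>))"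
    and "filterlim N at_top sequentially"
  shows "\<theta>0 = fpr_param M \<alpha> R Y
    \<and> asymptotically_linear M (\<lambda>n i \<omega>. (Rs n i \<omega>, Ys n i \<omega>)) \<theta>hat \<theta>0 \<phi>Y
    \<and> asymptotically_linear M (\<lambda>n i \<omega>. (Rs n i \<omega>, Fs n i \<omega>)) \<theta>hatf (fpr_param M \<alpha> R F) \<phi>f
    \<and> (\<forall>(lam::real) \<omega>hat.
          0 \<le> lam
          \<longrightarrow> (\<lambda>n. real n / real (N n)) \<longlonglongrightarrow> lam
          \<longrightarrow> conv_in_prob M \<omega>hat
                ((\<integral>\<omega>. \<phi>Y (R \<omega>, Y \<omega>) * \<phi>f (R \<omega>, F \<omega>) \<partial>M) / (\<integral>\<omega>. (\<phi>f (R \<omega>, F \<omega>))\<^sup>2 \<partial>M))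
          \<longrightarrow> (let \<theta>PP = \<lambda>n \<omega>. \<theta>hat n \<omega> + \<omega>hat n \<omega> * (\<theta>hatfN n \<omega> - \<theta>hatf n \<omega>)
               in weak_conv_m
                    (\<lambda>n. distr M borel (\<lambda>\<omega>. sqrt (real n) * (\<theta>PP n \<omega> - \<theta>0)))
                    (normal_law 0
                       ((\<integral>\<omega>. (\<phi>Y (R \<omega>, Y \<omega>))\<^sup>2 \<partial>M)
                        - (\<integral>\<omega>. \<phi>Y (R \<omega>, Y \<omega>) * \<phi>f (R \<omega>, F \<omega>) \<partial>M)\<^sup>2
                          / ((1 + lam) * (\<integral>\<omega>. (\<phi>f (R \<omega>, F \<omega>))\<^sup>2 \<partial>M))))))"
proof -
  interpret prob_space M by fact
  have Y [measurable]: "Y \<in> borel_measurable M" by fact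
  have f: "f \<in> borel_measurable borel" by fact
  have component: "(\<lambda>x. x $ j) \<in> borel_measurable (borel :: (real ^ 'd) measure)"
    by (intro borel_measurable_continuous_onI continuous_intros)
  have R: "R \<in> borel_measurable M" and F: "F \<in> borel_measurable M"
    unfolding R_def F_def
    by (auto intro: measurable_compose[OF \<open>X \<in> borel_measurable M\<close> component]
        measurable_compose[OF \<open>X \<in> borel_measurable M\<close> f])
  have Xs: "Rs n i \<in> borel_measurable M" "Fs n i \<in> borel_measurable M" if "i \<in> {1..n + N n}" for n i
  proof -
    have X: "Xs n i \<in> borel_measurable M"
      using \<open>\<And>n i. i \<in> {1..n + N n} \<Longrightarrow> Xs n i \<in> borel_measurable M\<close> that by blast
    show "Rs n i \<in> borel_measurable M" "Fs n i \<in> borel_measurable M"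
      unfolding Rs_def Fs_def
      by (auto intro: measurable_compose[OF X component] measurable_compose[OF X f])
  qed
  have Y01: "AE \<omega> in M. Y \<omega> \<in> {0, 1}" by fact
  \<comment> \<open>A binary outcome is bounded by 1, which supplies the second moment that the
    general statement asks of \<open>Y\<close> as well as of \<open>F\<close>.\<close>
  have Y2: "integrable M (\<lambda>\<omega>. (Y \<omega>)\<^sup>2)"
    by (rule integrable_const_bound[where B = 1]) (use Y01 in \<open>auto elim!: eventually_mono\<close>)
  have F2: "integrable M (\<lambda>\<omega>. (F \<omega>)\<^sup>2)" by fact
  have "integrable M F"
    by (rule square_integrable_imp_integrable[OF F F2])
  then have nzF: "(\<integral>\<omega>. 1 - F \<omega> \<partial>M) \<noteq> 0"
    using \<open>(\<integral>\<omega>. F \<omega> \<partial>M) * (1 - (\<integral>\<omega>. F \<omega> \<partial>M)) \<noteq> 0\<close> by (simp add: prob_space)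
  have nzY: "(\<integral>\<omega>. 1 - Y \<omega> \<partial>M) \<noteq> 0"
    using fpr_cond_prob_eq(2)[OF R Y Y01] \<open>\<P>(\<omega> in M. Y \<omega> = 1) < 1\<close> by simp
  have \<theta>0: "\<theta>0 = fpr_param M \<alpha> R Y"
    unfolding \<theta>0_def by (rule fpr_cond_prob_eq(1)[OF R Y Y01])
  note main = fpr_prediction_powered[where \<alpha> = \<alpha>, OF R F Y F2 Y2 nzF nzY
      \<open>0 < (\<integral>\<omega>. (\<phi>f (R \<omega>, F \<omega>))\<^sup>2 \<partial>M)\<close>[unfolded \<phi>f_def] Xs labeled_indep labeled_copies
      unlabeled_indep unlabeled_copies labeled_unlabeled_indep \<open>filterlim N at_top sequentially\<close>]
  show ?thesis
    unfolding Let_def \<theta>0 \<phi>Y_def \<phi>f_def \<theta>hat_def \<theta>hatf_def \<theta>hatfN_def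
    using main by blast
qed

end
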